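(* Let $\phi\colon S\to T$ be a semigroup morphism between two left cancellative semigroups with unit. Then $\phi$ extends to a *-homomorphism $\tilde\phi\colon C^*(S^* )\to C^*(T^* )$ (that is, $\tilde\phi(v_s)=v_{\phi(s)}$ for all $s\in S$).
   Context: For a left cancellative semigroup $S$ with unit, $S^*$ is the inverse semigroup generated by elements $v_p$ ($p\in S$) subject to $v_pv_q=v_{pq}$ and $v_p^*v_p=1$ (quotient of the free inverse semigroup on $\{v_p:p\in S\}$ by the congruence generated by these relations, $v_1=1$); $S$ is regarded as a subsemigroup of $S^*$ via $s\mapsto v_s$. For an inverse semigroup $P$, a *-representation is a homomorphism $\pi\colon P\to B(H)$ with $\pi(s^* )=\pi(s)^*$ (sending a zero element of $P$, if any, to $0$). The full C*-algebra $C^*(P)$ is the completion of the convolution *-algebra $\ell^1(P)$ in the supremum norm over all *-representations of $P$; elements of $P$ are regarded as elements of $C^*(P)$.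
   Formalization: Proved for all morphisms if *-representations need not kill a zero of S^* or T^*; with the convention that a zero goes to 0, proved when the induced map S^*→T^* sends a zero of S^* (if any) to a zero of T^*. Without this it fails, e.g. S={1}, T=N. *)

theory Defs
  imports "HOL-Analysis.Analysis"
begin

class left_cancel_monoid = monoid_mult +
  assumes left_cancel: "a * b = a * c \<Longrightarrow> b = c"

class inverse_semigroup = semigroup_mult +
  fixes istar :: "'a \<Rightarrow> 'a"
  assumes mult_istar_mult: "x * istar x * x = x"
    and istar_mult_istar: "istar x * x * istar x = istar x"
    and istar_unique: "\<lbrakk>x * y * x = x; y * x * y = y\<rbrakk> \<Longrightarrow> y = istar x"

definition zero_elements :: "'p::semigroup_mult set" where
  "zero_elements = {z. \<forall>s. s * z = z \<and> z * s = z}"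

datatype 'x inv_term = Gen 'x | Prod "'x inv_term" "'x inv_term" | Star "'x inv_term"

text \<open>The equational theory of inverse semigroups: semigroups with an involution such that
  \<open>x x\<^sup>* x = x\<close> and such that the elements \<open>x x\<^sup>*\<close> commute.\<close>

inductive inv_eq :: "'x inv_term \<Rightarrow> 'x inv_term \<Rightarrow> bool" where
  refl: "inv_eq a a"
| sym: "inv_eq a b \<Longrightarrow> inv_eq b a"
| trans: "inv_eq a b \<Longrightarrow> inv_eq b c \<Longrightarrow> inv_eq a c"
| prod: "inv_eq a a' \<Longrightarrow> inv_eq b b' \<Longrightarrow> inv_eq (Prod a b) (Prod a' b')"
| star: "inv_eq a b \<Longrightarrow> inv_eq (Star a) (Star b)"
| assoc: "inv_eq (Prod (Prod a b) c) (Prod a (Prod b c))"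
| star_star: "inv_eq (Star (Star a)) a"
| star_prod: "inv_eq (Star (Prod a b)) (Prod (Star b) (Star a))"
| regular: "inv_eq (Prod (Prod a (Star a)) a) a"
| comm: "inv_eq (Prod (Prod a (Star a)) (Prod b (Star b))) (Prod (Prod b (Star b)) (Prod a (Star a)))"

quotient_type 'x free_inv = "'x inv_term" / inv_eq
  by (intro equivpI reflpI sympI transpI) (auto intro: inv_eq.refl inv_eq.sym inv_eq.trans)

lift_definition free_gen :: "'x \<Rightarrow> 'x free_inv" is Gen .

lemma star_regular_unique_inverse:
  fixes m :: "'s \<Rightarrow> 's \<Rightarrow> 's" (infixl \<open>\<cdot>\<close> 70) and i :: "'s \<Rightarrow> 's"
  assumes as: "\<And>x y z. (x \<cdot> y) \<cdot> z = x \<cdot> (y \<cdot> z)"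
    and ii: "\<And>x. i (i x) = x"
    and im: "\<And>x y. i (x \<cdot> y) = i y \<cdot> i x"
    and reg: "\<And>x. (x \<cdot> i x) \<cdot> x = x"
    and comm: "\<And>x y. (x \<cdot> i x) \<cdot> (y \<cdot> i y) = (y \<cdot> i y) \<cdot> (x \<cdot> i x)"
    and xyx: "(x \<cdot> y) \<cdot> x = x" and yxy: "(y \<cdot> x) \<cdot> y = y"
  shows "y = i x"
proof -
  have reg': "i a \<cdot> (a \<cdot> i a) = i a" for a
    using reg[of "i a"] by (simp add: ii as)
  have sa: "i e = e" if e: "e \<cdot> e = e" for e
  proof -
    have ie: "i e \<cdot> i e = i e" by (metis e im)
    have "i e = i e \<cdot> (e \<cdot> i e)" by (simp add: reg')
    also have "\<dots> = (i e \<cdot> i (i e)) \<cdot> (e \<cdot> i e)" by (metis as e ii)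
    also have "\<dots> = (e \<cdot> i e) \<cdot> (i e \<cdot> i (i e))" by (rule comm)
    also have "\<dots> = (e \<cdot> (i e \<cdot> i e)) \<cdot> e" by (simp add: as ii)
    also have "\<dots> = e" by (simp add: ie reg)
    finally show ?thesis .
  qed
  have ic: "e \<cdot> f = f \<cdot> e" if "e \<cdot> e = e" "f \<cdot> f = f" for e f
    using comm[of e f] sa[OF that(1)] sa[OF that(2)] that by simp
  have id1: "(x \<cdot> y) \<cdot> (x \<cdot> y) = x \<cdot> y" and id2: "(y \<cdot> x) \<cdot> (y \<cdot> x) = y \<cdot> x"
    by (metis as xyx) (metis as xyx)
  have id3: "(x \<cdot> i x) \<cdot> (x \<cdot> i x) = x \<cdot> i x" and id4: "(i x \<cdot> x) \<cdot> (i x \<cdot> x) = i x \<cdot> x"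
    by (metis as reg) (metis as reg)
  have "y = (y \<cdot> x) \<cdot> y" using yxy by simp
  also have "\<dots> = y \<cdot> ((x \<cdot> i x) \<cdot> (x \<cdot> y))" by (metis as reg)
  also have "\<dots> = y \<cdot> ((x \<cdot> y) \<cdot> (x \<cdot> i x))" by (simp add: ic[OF id3 id1])
  also have "\<dots> = (y \<cdot> x) \<cdot> i x" by (metis as xyx)
  also have "\<dots> = (y \<cdot> x) \<cdot> ((i x \<cdot> x) \<cdot> i x)" by (simp add: as reg')
  also have "\<dots> = ((y \<cdot> x) \<cdot> (i x \<cdot> x)) \<cdot> i x" by (simp add: as)
  also have "\<dots> = ((i x \<cdot> x) \<cdot> (y \<cdot> x)) \<cdot> i x" by (simp add: ic[OF id2 id4])
  also have "\<dots> = (i x \<cdot> x) \<cdot> i x" by (metis as xyx)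
  also have "\<dots> = i x" by (simp add: as reg')
  finally show ?thesis .
qed

instantiation free_inv :: (type) inverse_semigroup
begin

lift_definition times_free_inv :: "'a free_inv \<Rightarrow> 'a free_inv \<Rightarrow> 'a free_inv" is Prod
  by (rule inv_eq.prod)

lift_definition istar_free_inv :: "'a free_inv \<Rightarrow> 'a free_inv" is Star
  by (rule inv_eq.star)

instance
proof
  fix x y z :: "'a free_inv"
  have as: "(a * b) * c = a * (b * c)" for a b c :: "'a free_inv"
    by transfer (rule inv_eq.assoc)
  have ii: "istar (istar a) = a" for a :: "'a free_inv"
    by transfer (rule inv_eq.star_star)
  have im: "istar (a * b) = istar b * istar a" for a b :: "'a free_inv"
    by transfer (rule inv_eq.star_prod)
  have reg: "(a * istar a) * a = a" for a :: "'a free_inv"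
    by transfer (rule inv_eq.regular)
  have comm: "(a * istar a) * (b * istar b) = (b * istar b) * (a * istar a)" for a b :: "'a free_inv"
    by transfer (rule inv_eq.comm)
  show "x * y * z = x * (y * z)" by (rule as)
  show "x * istar x * x = x" by (rule reg)
  show "istar x * x * istar x = istar x" using reg[of "istar x"] by (simp add: ii)
  show "y = istar x" if "x * y * x = x" "y * x * y = y"
    by (rule star_regular_unique_inverse[OF as ii im reg comm that])
qed

end

text \<open>The unit on the right-hand side of \<open>v\<^sub>p\<^sup>* v\<^sub>p = 1\<close> is \<open>v\<^sub>1\<close>.\<close>

inductive univ_inv_cong :: "'s::left_cancel_monoid free_inv \<Rightarrow> 's free_inv \<Rightarrow> bool" where
  mult_rel: "univ_inv_cong (free_gen p * free_gen q) (free_gen (p * q))"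
| isometry_rel: "univ_inv_cong (istar (free_gen p) * free_gen p) (free_gen 1)"
| refl: "univ_inv_cong a a"
| sym: "univ_inv_cong a b \<Longrightarrow> univ_inv_cong b a"
| trans: "univ_inv_cong a b \<Longrightarrow> univ_inv_cong b c \<Longrightarrow> univ_inv_cong a c"
| mult: "univ_inv_cong a a' \<Longrightarrow> univ_inv_cong b b' \<Longrightarrow> univ_inv_cong (a * b) (a' * b')"
| star: "univ_inv_cong a b \<Longrightarrow> univ_inv_cong (istar a) (istar b)"

quotient_type (overloaded) 's univ_inv = "'s::left_cancel_monoid free_inv" / univ_inv_cong
  by (intro equivpI reflpI sympI transpI)
    (auto intro: univ_inv_cong.refl univ_inv_cong.sym univ_inv_cong.trans)

lift_definition v :: "'s::left_cancel_monoid \<Rightarrow> 's univ_inv" is free_gen .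

instantiation univ_inv :: (left_cancel_monoid) inverse_semigroup
begin

lift_definition times_univ_inv :: "'a univ_inv \<Rightarrow> 'a univ_inv \<Rightarrow> 'a univ_inv" is "(*)"
  by (rule univ_inv_cong.mult)

lift_definition istar_univ_inv :: "'a univ_inv \<Rightarrow> 'a univ_inv" is istar
  by (rule univ_inv_cong.star)

instance
proof
  fix x y z :: "'a univ_inv"
  have as: "(a * b) * c = a * (b * c)" for a b c :: "'a univ_inv"
    by transfer (simp add: mult.assoc univ_inv_cong.refl)
  have ii: "istar (istar a) = a" for a :: "'a univ_inv"
  proof (transfer)
    fix a :: "'a free_inv"
    have "istar (istar a) = a" by transfer (rule inv_eq.star_star)
    then show "univ_inv_cong (istar (istar a)) a" by (simp add: univ_inv_cong.refl)
  qed
  have im: "istar (a * b) = istar b * istar a" for a b :: "'a univ_inv"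
  proof (transfer)
    fix a b :: "'a free_inv"
    have "istar (a * b) = istar b * istar a" by transfer (rule inv_eq.star_prod)
    then show "univ_inv_cong (istar (a * b)) (istar b * istar a)" by (simp add: univ_inv_cong.refl)
  qed
  have reg: "(a * istar a) * a = a" for a :: "'a univ_inv"
    by transfer (simp add: mult_istar_mult univ_inv_cong.refl)
  have comm: "(a * istar a) * (b * istar b) = (b * istar b) * (a * istar a)" for a b :: "'a univ_inv"
  proof (transfer)
    fix a b :: "'a free_inv"
    have "(a * istar a) * (b * istar b) = (b * istar b) * (a * istar a)"
      by transfer (rule inv_eq.comm)
    then show "univ_inv_cong ((a * istar a) * (b * istar b)) ((b * istar b) * (a * istar a))"
      by (simp add: univ_inv_cong.refl)
  qed
  show "x * y * z = x * (y * z)" by (rule as)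
  show "x * istar x * x = x" by (rule reg)
  show "istar x * x * istar x = istar x" using reg[of "istar x"] by (simp add: ii)
  show "y = istar x" if "x * y * x = x" "y * x * y = y"
    by (rule star_regular_unique_inverse[OF as ii im reg comm that])
qed

end

lemma v_mult: "v p * v q = v (p * q)"
  by transfer (rule univ_inv_cong.mult_rel)

lemma v_isometry: "istar (v p) * v p = v 1"
  by transfer (rule univ_inv_cong.isometry_rel)

lemma istar_istar_univ_inv: "istar (istar x) = (x :: 's::left_cancel_monoid univ_inv)"
  by (metis istar_unique mult_istar_mult istar_mult_istar)

lemma istar_mult_univ_inv: "istar (x * y) = istar y * istar (x :: 's::left_cancel_monoid univ_inv)"
proof (transfer)
  fix x y :: "'s free_inv"
  have "istar (x * y) = istar y * istar x" by transfer (rule inv_eq.star_prod)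
  then show "univ_inv_cong (istar (x * y)) (istar y * istar x)" by (simp add: univ_inv_cong.refl)
qed

lemma univ_inv_induct:
  assumes "\<And>p. P (v p)" "\<And>x y. P x \<Longrightarrow> P y \<Longrightarrow> P (x * y)" "\<And>x. P x \<Longrightarrow> P (istar x)"
  shows "P (x :: 's::left_cancel_monoid univ_inv)"
proof -
  have "P (abs_univ_inv (abs_free_inv t))" for t
  proof (induction t)
    case (Gen p)
    then show ?case using assms(1)[of p] by (simp add: v.abs_eq free_gen.abs_eq)
  next
    case (Prod s t)
    then show ?case using assms(2) by (metis times_univ_inv.abs_eq times_free_inv.abs_eq)
  next
    case (Star t)
    then show ?case using assms(3) by (metis istar_univ_inv.abs_eq istar_free_inv.abs_eq)
  qed
  then show ?thesis
    by (metis Quotient3_abs_rep Quotient3_univ_inv Quotient3_free_inv)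
qed

lemma v_one_unit: "v 1 * x = x" "x * v 1 = (x :: 's::left_cancel_monoid univ_inv)"
proof -
  have s1: "istar (v 1) = (v 1 :: 's univ_inv)"
    by (metis istar_unique v_mult mult_1)
  have "v 1 * x = x \<and> x * v 1 = x"
  proof (induction x rule: univ_inv_induct)
    case (3 x)
    then show ?case by (metis istar_mult_univ_inv s1)
  qed (simp_all add: v_mult mult.assoc, metis mult.assoc)
  then show "v 1 * x = x" "x * v 1 = x" by auto
qed

instantiation univ_inv :: (left_cancel_monoid) monoid_mult
begin
definition "1 = v 1"
instance by standard (simp_all add: one_univ_inv_def v_one_unit)
end

record 'h hspace =
  hvecs :: "'h set"
  hzero :: 'h
  hadd :: "'h \<Rightarrow> 'h \<Rightarrow> 'h"
  hscale :: "complex \<Rightarrow> 'h \<Rightarrow> 'h"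
  hinner :: "'h \<Rightarrow> 'h \<Rightarrow> complex"

definition hnorm :: "'h hspace \<Rightarrow> 'h \<Rightarrow> real" where
  "hnorm H x = sqrt (Re (hinner H x x))"

definition hdist :: "'h hspace \<Rightarrow> 'h \<Rightarrow> 'h \<Rightarrow> real" where
  "hdist H x y = hnorm H (hadd H x (hscale H (-1) y))"

definition complex_vector_space :: "'h hspace \<Rightarrow> bool" where
  "complex_vector_space H \<longleftrightarrow>
     hzero H \<in> hvecs H \<and>
     (\<forall>x\<in>hvecs H. \<forall>y\<in>hvecs H. hadd H x y \<in> hvecs H) \<and>
     (\<forall>a. \<forall>x\<in>hvecs H. hscale H a x \<in> hvecs H) \<and>
     (\<forall>x\<in>hvecs H. \<forall>y\<in>hvecs H. \<forall>z\<in>hvecs H. hadd H (hadd H x y) z = hadd H x (hadd H y z)) \<and>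
     (\<forall>x\<in>hvecs H. \<forall>y\<in>hvecs H. hadd H x y = hadd H y x) \<and>
     (\<forall>x\<in>hvecs H. hadd H (hzero H) x = x) \<and>
     (\<forall>x\<in>hvecs H. hadd H x (hscale H (-1) x) = hzero H) \<and>
     (\<forall>a. \<forall>x\<in>hvecs H. \<forall>y\<in>hvecs H. hscale H a (hadd H x y) = hadd H (hscale H a x) (hscale H a y)) \<and>
     (\<forall>a b. \<forall>x\<in>hvecs H. hscale H (a + b) x = hadd H (hscale H a x) (hscale H b x)) \<and>
     (\<forall>a b. \<forall>x\<in>hvecs H. hscale H (a * b) x = hscale H a (hscale H b x)) \<and>
     (\<forall>x\<in>hvecs H. hscale H 1 x = x)"

definition complex_inner_product :: "'h hspace \<Rightarrow> bool" where
  "complex_inner_product H \<longleftrightarrow>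
     (\<forall>x\<in>hvecs H. \<forall>y\<in>hvecs H. \<forall>z\<in>hvecs H. hinner H (hadd H x y) z = hinner H x z + hinner H y z) \<and>
     (\<forall>a. \<forall>x\<in>hvecs H. \<forall>y\<in>hvecs H. hinner H (hscale H a x) y = a * hinner H x y) \<and>
     (\<forall>x\<in>hvecs H. \<forall>y\<in>hvecs H. hinner H y x = cnj (hinner H x y)) \<and>
     (\<forall>x\<in>hvecs H. x \<noteq> hzero H \<longrightarrow> Re (hinner H x x) > 0)"

definition hcomplete :: "'h hspace \<Rightarrow> bool" where
  "hcomplete H \<longleftrightarrow>
     (\<forall>X. (\<forall>n::nat. X n \<in> hvecs H) \<and> (\<forall>e>0. \<exists>M. \<forall>m\<ge>M. \<forall>n\<ge>M. hdist H (X m) (X n) < e)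
        \<longrightarrow> (\<exists>x\<in>hvecs H. (\<lambda>n. hdist H (X n) x) \<longlonglongrightarrow> 0))"

definition hilbert_space :: "'h hspace \<Rightarrow> bool" where
  "hilbert_space H \<longleftrightarrow> complex_vector_space H \<and> complex_inner_product H \<and> hcomplete H"

definition bounded_operator :: "'h hspace \<Rightarrow> ('h \<Rightarrow> 'h) \<Rightarrow> bool" where
  "bounded_operator H A \<longleftrightarrow>
     (\<forall>x\<in>hvecs H. A x \<in> hvecs H) \<and>
     (\<forall>x\<in>hvecs H. \<forall>y\<in>hvecs H. A (hadd H x y) = hadd H (A x) (A y)) \<and>
     (\<forall>a. \<forall>x\<in>hvecs H. A (hscale H a x) = hscale H a (A x)) \<and>
     (\<exists>C. \<forall>x\<in>hvecs H. hnorm H (A x) \<le> C * hnorm H x)"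

definition op_norm :: "'h hspace \<Rightarrow> ('h \<Rightarrow> 'h) \<Rightarrow> real" where
  "op_norm H A = Sup {hnorm H (A x) | x. x \<in> hvecs H \<and> hnorm H x \<le> 1}"

text \<open>The parameter \<open>Z\<close> is the set of elements of \<open>P\<close> that have to be sent to \<open>0\<close>. It is either
  \<open>zero_elements\<close>, i.e. a zero of \<open>P\<close>, if there is one, is sent to \<open>0\<close>, or \<open>{}\<close>, i.e. \<open>P\<close> is
  treated as an inverse semigroup without distinguished zero. Note that \<open>S\<^sup>*\<close> may happen to have
  a zero although no zero occurs in its presentation: for \<open>S = {1}\<close> the unit is one, and if \<open>S\<close>
  is the monoid of injections of the natural numbers into themselves, then \<open>v\<^sub>f\<^sup>* v\<^sub>g\<close> is one
  whenever \<open>f\<close> and \<open>g\<close> have disjoint ranges.\<close>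

definition star_representation ::
    "'p::inverse_semigroup set \<Rightarrow> 'h hspace \<Rightarrow> ('p \<Rightarrow> 'h \<Rightarrow> 'h) \<Rightarrow> bool" where
  "star_representation Z H \<pi> \<longleftrightarrow>
     (\<forall>s. bounded_operator H (\<pi> s)) \<and>
     (\<forall>s t. \<forall>x\<in>hvecs H. \<pi> (s * t) x = \<pi> s (\<pi> t x)) \<and>
     (\<forall>s. \<forall>x\<in>hvecs H. \<forall>y\<in>hvecs H. hinner H (\<pi> (istar s) x) y = hinner H x (\<pi> s y)) \<and>
     (\<forall>z\<in>Z. \<forall>x\<in>hvecs H. \<pi> z x = hzero H)"

definition l1 :: "('p \<Rightarrow> complex) set" where
  "l1 = {f. (\<lambda>p. norm (f p)) summable_on UNIV}"

definition convolution :: "('p::inverse_semigroup \<Rightarrow> complex) \<Rightarrow> ('p \<Rightarrow> complex) \<Rightarrow> 'p \<Rightarrow> complex" where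
  "convolution f g = (\<lambda>r. \<Sum>\<^sub>\<infinity>(s, t)\<in>{(s, t). s * t = r}. f s * g t)"

definition l1_star :: "('p::inverse_semigroup \<Rightarrow> complex) \<Rightarrow> 'p \<Rightarrow> complex" where
  "l1_star f = (\<lambda>s. cnj (f (istar s)))"

definition point_mass :: "'p \<Rightarrow> 'p \<Rightarrow> complex" where
  "point_mass s = (\<lambda>t. if t = s then 1 else 0)"

text \<open>The operator \<open>\<pi>(f) = \<Sum>\<^sub>p f(p) \<pi>(p)\<close>, the series being evaluated weakly.\<close>

definition integrated_form ::
    "'h hspace \<Rightarrow> ('p \<Rightarrow> 'h \<Rightarrow> 'h) \<Rightarrow> ('p \<Rightarrow> complex) \<Rightarrow> 'h \<Rightarrow> 'h" where
  "integrated_form H \<pi> f x =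
     (THE y. y \<in> hvecs H \<and> (\<forall>z\<in>hvecs H. hinner H y z = (\<Sum>\<^sub>\<infinity>p. f p * hinner H (\<pi> p x) z)))"

text \<open>The supremum over all *-representations. A type of vectors has to be fixed here: the
  Hilbert spaces are those whose underlying set consists of functions \<open>P \<rightarrow> \<complex>\<close> (with arbitrary
  operations). This is no restriction. Let \<open>\<pi>\<close> be a *-representation on any Hilbert space and
  \<open>x\<close> a vector. The closed span \<open>K\<close> of \<open>{\<pi>(p)x. p \<in> P}\<close> is invariant, hence \<open>\<pi>(f)x = \<pi>(f)x'\<close>
  for the projection \<open>x'\<close> of \<open>x\<close> to \<open>K\<close>; and \<open>k \<mapsto> (p \<mapsto> \<langle>k, \<pi>(p)x\<rangle>)\<close> is injective on \<open>K\<close>,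
  so that \<open>K\<close> can be transported to a set of functions \<open>P \<rightarrow> \<complex>\<close>. Hence the norms
  \<open>\<parallel>\<pi>(f)x\<parallel>\<close> are already attained on Hilbert spaces of this form.\<close>

definition full_norm :: "'p::inverse_semigroup set \<Rightarrow> ('p \<Rightarrow> complex) \<Rightarrow> real" where
  "full_norm Z f =
     Sup {op_norm H (integrated_form H \<pi> f) | (H :: ('p \<Rightarrow> complex) hspace) \<pi>.
            hilbert_space H \<and> star_representation Z H \<pi>}"

record 'a star_algebra =
  acarrier :: "'a set"
  aadd :: "'a \<Rightarrow> 'a \<Rightarrow> 'a"
  ascale :: "complex \<Rightarrow> 'a \<Rightarrow> 'a"
  amult :: "'a \<Rightarrow> 'a \<Rightarrow> 'a"
  astar :: "'a \<Rightarrow> 'a"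
  anorm :: "'a \<Rightarrow> real"

definition star_homomorphism ::
    "'a star_algebra \<Rightarrow> 'b star_algebra \<Rightarrow> ('a \<Rightarrow> 'b) \<Rightarrow> bool" where
  "star_homomorphism A B \<Phi> \<longleftrightarrow>
     (\<forall>x\<in>acarrier A. \<Phi> x \<in> acarrier B) \<and>
     (\<forall>x\<in>acarrier A. \<forall>y\<in>acarrier A. \<Phi> (aadd A x y) = aadd B (\<Phi> x) (\<Phi> y)) \<and>
     (\<forall>c. \<forall>x\<in>acarrier A. \<Phi> (ascale A c x) = ascale B c (\<Phi> x)) \<and>
     (\<forall>x\<in>acarrier A. \<forall>y\<in>acarrier A. \<Phi> (amult A x y) = amult B (\<Phi> x) (\<Phi> y)) \<and>
     (\<forall>x\<in>acarrier A. \<Phi> (astar A x) = astar B (\<Phi> x))"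

text \<open>The completion consists of Cauchy sequences in \<open>\<ell>\<^sup>1(P)\<close> modulo null sequences, with the
  operations performed on representatives.\<close>

type_synonym 'p l1_seq = "nat \<Rightarrow> 'p \<Rightarrow> complex"

definition cauchy_seqs :: "'p::inverse_semigroup set \<Rightarrow> 'p l1_seq set" where
  "cauchy_seqs Z = {X. (\<forall>n. X n \<in> l1) \<and>
     (\<forall>e>0. \<exists>M. \<forall>m\<ge>M. \<forall>n\<ge>M. full_norm Z (\<lambda>p. X m p - X n p) < e)}"

definition null_rel :: "'p::inverse_semigroup set \<Rightarrow> ('p l1_seq \<times> 'p l1_seq) set" where
  "null_rel Z = {(X, Y). X \<in> cauchy_seqs Z \<and> Y \<in> cauchy_seqs Z \<and>
     (\<lambda>n. full_norm Z (\<lambda>p. X n p - Y n p)) \<longlonglongrightarrow> 0}"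

definition Cstar :: "'p::inverse_semigroup set \<Rightarrow> 'p l1_seq set star_algebra" where
  "Cstar Z =
     \<lparr>acarrier = cauchy_seqs Z // null_rel Z,
      aadd = (\<lambda>A B. null_rel Z `` {(\<lambda>n p. X n p + Y n p) | X Y. X \<in> A \<and> Y \<in> B}),
      ascale = (\<lambda>c A. null_rel Z `` {(\<lambda>n p. c * X n p) | X. X \<in> A}),
      amult = (\<lambda>A B. null_rel Z `` {(\<lambda>n. convolution (X n) (Y n)) | X Y. X \<in> A \<and> Y \<in> B}),
      astar = (\<lambda>A. null_rel Z `` {(\<lambda>n. l1_star (X n)) | X. X \<in> A}),
      anorm = (\<lambda>A. lim (\<lambda>n. full_norm Z ((SOME X. X \<in> A) n)))\<rparr>"

definition Cstar_elem :: "'p::inverse_semigroup set \<Rightarrow> 'p \<Rightarrow> 'p l1_seq set" where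
  "Cstar_elem Z p = null_rel Z `` {\<lambda>n. point_mass p}"

end

theory Submission
  imports Defs
begin

text \<open>The morphism \<open>\<phi>\<close> preserves the unit, so \<open>s \<mapsto> v\<^bsub>\<phi>(s)\<^esub>\<close> respects the relations of \<open>S\<^sup>*\<close>
  and induces a homomorphism \<open>\<psi>\<close> from \<open>S\<^sup>*\<close> to \<open>T\<^sup>*\<close>. Summation over the fibres of
  \<open>\<psi>\<close> is a *-homomorphism \<open>\<psi>\<^sub>*\<close> between the \<open>\<ell>\<^sup>1\<close>-algebras with
  \<open>\<pi>(\<psi>\<^sub>*f) = (\<pi> \<circ> \<psi>)(f)\<close> for every *-representation \<open>\<pi>\<close> of \<open>T\<^sup>*\<close>. Since
  \<open>\<pi> \<circ> \<psi>\<close> is a *-representation of \<open>S\<^sup>*\<close>, \<open>\<psi>\<^sub>*\<close> is contractive for the full norms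
  and hence extends to the completions. The full norm of \<open>\<ell>\<^sup>1(S\<^sup>*)\<close> is a supremum over Hilbert
  spaces of functions on \<open>S\<^sup>*\<close> only, whereas \<open>\<pi> \<circ> \<psi>\<close> acts on functions on \<open>T\<^sup>*\<close>; the
  cyclic parts of \<open>\<pi> \<circ> \<psi>\<close> therefore have to be transported to spaces of the former kind.\<close>

section \<open>Absolutely summable functions and inverse semigroups\<close>

text \<open>For complex functions unconditional and absolute summability coincide, so closure
  properties of \<open>l1\<close> reduce to those of \<open>summable_on\<close>.\<close>

lemma l1_iff_summable: "f \<in> l1 \<longleftrightarrow> f summable_on UNIV"
  by (simp add: l1_def summable_on_iff_abs_summable_on_complex[of f])

lemma l1_summable_on: "f \<in> l1 \<Longrightarrow> f summable_on A"
  using l1_iff_summable summable_on_subset_banach by blast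

lemma l1_add: "f \<in> l1 \<Longrightarrow> g \<in> l1 \<Longrightarrow> (\<lambda>p. f p + g p) \<in> l1"
  by (simp add: l1_iff_summable summable_on_add)

lemma l1_scale: "f \<in> l1 \<Longrightarrow> (\<lambda>p. c * f p) \<in> l1"
  by (simp add: l1_iff_summable summable_on_cmult_right)

lemma l1_diff: "f \<in> l1 \<Longrightarrow> g \<in> l1 \<Longrightarrow> (\<lambda>p. f p - g p) \<in> l1"
  using l1_add[OF _ l1_scale[of g "-1"], of f] by simp

lemma l1_dominated:
  assumes "f \<in> l1" "\<And>p. cmod (g p) \<le> C * cmod (f p)" shows "g \<in> l1"
  unfolding l1_def mem_Collect_eq
  by (rule Infinite_Sum.abs_summable_on_comparison_test'[where g="\<lambda>p. C * cmod (f p)"])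
    (use assms in \<open>auto simp: l1_def intro: summable_on_cmult_right\<close>)

lemma l1_mult_bounded:
  assumes "f \<in> l1" "\<And>p. cmod (c p) \<le> C" shows "(\<lambda>p. f p * c p) \<in> l1"
  by (rule l1_dominated[OF assms(1), of _ C])
    (simp add: norm_mult mult.commute mult_right_mono assms(2))

lemma l1_reindex: "bij k \<Longrightarrow> f \<in> l1 \<Longrightarrow> (\<lambda>p. f (k p)) \<in> l1"
  by (simp add: l1_iff_summable summable_on_reindex_bij_betw)

lemma l1_cnj: "f \<in> l1 \<Longrightarrow> (\<lambda>p. cnj (f p)) \<in> l1"
  by (simp add: l1_iff_summable)

lemma l1_tensor:
  assumes "f \<in> l1" "g \<in> l1" shows "(\<lambda>(s, t). f s * g t) \<in> l1"
proof -
  have "(\<lambda>p. cmod ((\<lambda>(s, t). f s * g t) p)) summable_on UNIV \<times> UNIV"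
    using assms by (subst Infinite_Sum.abs_summable_on_Sigma_iff)
      (auto simp: l1_def norm_mult infsum_cmult_right' abs_mult
        intro!: summable_on_cmult_right summable_on_cmult_left)
  then show ?thesis by (simp add: l1_def)
qed

lemma infsum_UNIV_Times:
  assumes "h \<in> l1" shows "(\<Sum>\<^sub>\<infinity>s. \<Sum>\<^sub>\<infinity>t. h (s, t)) = infsum h UNIV"
  using infsum_Sigma_banach[of h UNIV "\<lambda>_. UNIV"] assms by (simp add: l1_summable_on)

section \<open>Pushforward of summable functions along a map\<close>

definition push :: "('a \<Rightarrow> 'b) \<Rightarrow> ('a \<Rightarrow> complex) \<Rightarrow> 'b \<Rightarrow> complex" where
  "push k f = (\<lambda>q. \<Sum>\<^sub>\<infinity>p\<in>{p. k p = q}. f p)"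

text \<open>The graph of \<open>k\<close> turns a preimage into the disjoint union of the fibres
  over \<open>B\<close>, which makes the Fubini rules for \<open>Sigma\<close> applicable.\<close>

lemma bij_betw_fibres: "bij_betw (\<lambda>p. (k p, p)) {p. k p \<in> B} (Sigma B (\<lambda>q. {p. k p = q}))"
  by (auto intro!: bij_betwI[where g=snd])

text \<open>Fubini over the disjoint union of fibres. Taking for \<open>B\<close> a fibre of a
  second map yields functoriality (\<open>push_push\<close>); \<open>B = UNIV\<close> yields
  invariance of the total sum.\<close>

lemma push_infsum_on:
  assumes "f \<in> l1" shows "infsum (push k f) B = infsum f {p. k p \<in> B}"
proof -
  let ?S = "Sigma B (\<lambda>q. {p. k p = q})"
  have "(\<lambda>x. f (snd x)) summable_on ?S"
    using summable_on_reindex_bij_betw[OF bij_betw_fibres[of k B], of "\<lambda>x. f (snd x)"]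
    by (simp add: assms l1_summable_on)
  then have "infsum (push k f) B = infsum (\<lambda>x. f (snd x)) ?S"
    using infsum_Sigma_banach[of "\<lambda>x. f (snd x)" B "\<lambda>q. {p. k p = q}"] by (simp add: push_def)
  also have "\<dots> = infsum f {p. k p \<in> B}"
    using infsum_reindex_bij_betw[OF bij_betw_fibres[of k B], of "\<lambda>x. f (snd x)"] by simp
  finally show ?thesis .
qed

lemma push_l1:
  assumes "f \<in> l1" shows "push k f \<in> l1"
proof -
  let ?S = "Sigma UNIV (\<lambda>q. {p. k p = q})"
  have "(\<lambda>x. f (snd x)) summable_on ?S"
    using summable_on_reindex_bij_betw[OF bij_betw_fibres[of k UNIV], of "\<lambda>x. f (snd x)"]
    by (simp add: assms l1_summable_on)
  then show ?thesis
    using summable_on_Sigma_banach[of "\<lambda>q p. f p" UNIV "\<lambda>q. {p. k p = q}"]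
    by (simp add: push_def l1_iff_summable case_prod_unfold)
qed

lemma push_add:
  "f \<in> l1 \<Longrightarrow> g \<in> l1 \<Longrightarrow> push k (\<lambda>p. f p + g p) = (\<lambda>q. push k f q + push k g q)"
  by (simp add: push_def infsum_add l1_summable_on)

lemma push_scale: "push k (\<lambda>p. c * f p) = (\<lambda>q. c * push k f q)"
  by (simp add: push_def infsum_cmult_right')

lemma push_diff:
  "f \<in> l1 \<Longrightarrow> g \<in> l1 \<Longrightarrow> push k (\<lambda>p. f p - g p) = (\<lambda>q. push k f q - push k g q)"
  using push_add[OF _ l1_scale[of g "-1"], of f k] push_scale[of k "-1" g] by simp

lemma push_push: "f \<in> l1 \<Longrightarrow> push k (push j f) = push (k \<circ> j) f"
  unfolding push_def[of k] push_def[of "k \<circ> j"] by (simp add: push_infsum_on)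

text \<open>The second factor is constant on each fibre of \<open>k\<close> and can be pulled out of
  the fibre sum.\<close>

lemma push_mult_comp: "push k (\<lambda>p. f p * c (k p)) = (\<lambda>q. push k f q * c q)"
proof
  fix q
  have "push k (\<lambda>p. f p * c (k p)) q = (\<Sum>\<^sub>\<infinity>p\<in>{p. k p = q}. f p * c q)"
    unfolding push_def by (rule infsum_cong) auto
  then show "push k (\<lambda>p. f p * c (k p)) q = push k f q * c q"
    by (simp add: push_def infsum_cmult_left')
qed

text \<open>Change of variables; boundedness of \<open>c\<close> keeps the terms in
  \<open>l1\<close>. With \<open>c\<close> a coefficient of a representation this evaluates
  integrated forms, both of convolutions and of pushforwards.\<close>

lemma infsum_push_mult:
  assumes "f \<in> l1" "\<And>q. cmod (c q) \<le> C"
  shows "(\<Sum>\<^sub>\<infinity>q. push k f q * c q) = (\<Sum>\<^sub>\<infinity>p. f p * c (k p))"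
  using push_infsum_on[OF l1_mult_bounded[OF assms(1), of "\<lambda>p. c (k p)" C], of k UNIV] assms(2)
  by (simp add: push_mult_comp)

text \<open>A fibre of \<open>map_prod k j\<close> is a product of fibres, so Fubini factors the
  sum.\<close>

lemma push_tensor:
  assumes "f \<in> l1" "g \<in> l1"
  shows "push (map_prod k j) (\<lambda>(s, t). f s * g t) = (\<lambda>(s, t). push k f s * push j g t)"
proof (rule ext, clarify)
  fix s t
  have "push (map_prod k j) (\<lambda>(s, t). f s * g t) (s, t)
      = infsum (\<lambda>(s, t). f s * g t) ({p. k p = s} \<times> {q. j q = t})"
    unfolding push_def by (rule infsum_cong_neutral) auto
  also have "\<dots> = (\<Sum>\<^sub>\<infinity>p\<in>{p. k p = s}. \<Sum>\<^sub>\<infinity>q\<in>{q. j q = t}. f p * g q)"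
    by (rule infsum_Sigma'_banach[symmetric]) (simp add: l1_tensor[OF assms] l1_summable_on)
  also have "\<dots> = push k f s * push j g t"
    by (simp add: push_def infsum_cmult_right' infsum_cmult_left')
  finally show "push (map_prod k j) (\<lambda>(s, t). f s * g t) (s, t) = push k f s * push j g t" .
qed

lemma push_point_mass: "push k (point_mass p) = point_mass (k p)"
proof
  fix q
  have "push k (point_mass p) q = infsum (point_mass p) ({p} \<inter> {p. k p = q})"
    unfolding push_def by (rule infsum_cong_neutral) (auto simp: point_mass_def)
  then show "push k (point_mass p) q = point_mass (k p) q"
    by (cases "k p = q") (auto simp: point_mass_def)
qed

lemma point_mass_l1: "point_mass p \<in> l1"
proof -
  have "point_mass p summable_on UNIV \<longleftrightarrow> point_mass p summable_on {p}"
    by (rule summable_on_cong_neutral) (auto simp: point_mass_def)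
  then show ?thesis by (simp add: l1_iff_summable)
qed

text \<open>Reduces summability of convolutions, their additivity and their naturality to the
  corresponding facts about \<open>push\<close>.\<close>

lemma convolution_eq_push: "convolution f g = push (\<lambda>(s, t). s * t) (\<lambda>(s, t). f s * g t)"
  by (simp add: convolution_def push_def case_prod_unfold)

lemma convolution_l1: "f \<in> l1 \<Longrightarrow> g \<in> l1 \<Longrightarrow> convolution f g \<in> l1"
  by (simp add: convolution_eq_push push_l1 l1_tensor)

lemma convolution_diff_left:
  assumes "f \<in> l1" "g \<in> l1" "h \<in> l1"
  shows "convolution (\<lambda>p. f p - g p) h = (\<lambda>p. convolution f h p - convolution g h p)"
  using push_diff[OF l1_tensor[OF assms(1,3)] l1_tensor[OF assms(2,3)]]
  by (simp add: convolution_eq_push case_prod_unfold left_diff_distrib)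

lemma convolution_diff_right:
  assumes "f \<in> l1" "g \<in> l1" "h \<in> l1"
  shows "convolution h (\<lambda>p. f p - g p) = (\<lambda>p. convolution h f p - convolution h g p)"
  using push_diff[OF l1_tensor[OF assms(3,1)] l1_tensor[OF assms(3,2)]]
  by (simp add: convolution_eq_push case_prod_unfold right_diff_distrib)

section \<open>Inverse semigroups and pushforward along their homomorphisms\<close>

lemma istar_istar: "istar (istar x) = (x :: 'p::inverse_semigroup)"
  by (metis istar_unique mult_istar_mult istar_mult_istar)

lemma idempotent_mult_istar: "x * istar x * (x * istar x) = x * istar (x :: 'p::inverse_semigroup)"
  by (metis mult.assoc mult_istar_mult)

lemma istar_idempotent: "e * e = e \<Longrightarrow> istar e = (e :: 'p::inverse_semigroup)"
  by (metis istar_unique)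

text \<open>If \<open>a\<close> is the inverse of \<open>ef\<close>, then so is \<open>fae\<close>; hence \<open>a = fae\<close> is idempotent.\<close>

lemma idempotent_mult:
  fixes e f :: "'p::inverse_semigroup"
  assumes e: "e * e = e" and f: "f * f = f"
  shows "(e * f) * (e * f) = e * f"
proof -
  define a where "a = istar (e * f)"
  have ee: "e * (e * x) = e * x" and ff: "f * (f * x) = f * x" for x
    using e f by (simp_all flip: mult.assoc)
  have efa: "e * (f * (a * (e * f))) = e * f"
    using mult_istar_mult[of "e * f"] by (simp add: a_def mult.assoc)
  have aef: "a * (e * (f * a)) = a"
    using istar_mult_istar[of "e * f"] by (simp add: a_def mult.assoc)
  have aef': "a * (e * (f * (a * x))) = a * x" for x
    using aef by (metis mult.assoc)
  have "f * a * e = istar (e * f)"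
    by (rule istar_unique) (simp_all add: mult.assoc ee ff efa aef')
  then have a: "a = f * a * e" by (simp add: a_def)
  have "a * a = (f * a * e) * (f * a * e)"
    by (simp only: a[symmetric])
  also have "\<dots> = f * a * e"
    by (simp add: aef' mult.assoc)
  also note a[symmetric]
  finally have aa: "a * a = a" .
  then have "e * f = a"
    using istar_idempotent[OF aa] by (simp add: a_def istar_istar)
  then show ?thesis using aa by simp
qed

text \<open>Since \<open>e * f\<close> and \<open>f * e\<close> are both idempotent,
  \<open>f * e\<close> satisfies the equations of the inverse of \<open>e * f\<close>; but an
  idempotent is its own inverse.\<close>

lemma idempotents_commute:
  fixes e f :: "'p::inverse_semigroup"
  assumes e: "e * e = e" and f: "f * f = f"
  shows "e * f = f * e"
proof -
  have ee: "e * (e * x) = e * x" and ff: "f * (f * x) = f * x" for x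
    using e f by (simp_all flip: mult.assoc)
  have "f * e = istar (e * f)"
    using idempotent_mult[OF e f] idempotent_mult[OF f e]
    by (intro istar_unique) (simp_all add: mult.assoc ee ff)
  then show ?thesis
    using istar_idempotent[OF idempotent_mult[OF e f]] by simp
qed

text \<open>The idempotents \<open>y * istar y\<close> and \<open>istar x * x\<close> commute;
  swapping them verifies both equations that determine the inverse of \<open>x * y\<close>.\<close>

lemma istar_mult: "istar (x * y) = istar y * istar (x :: 'p::inverse_semigroup)"
proof -
  have c: "y * istar y * (istar x * x) = istar x * x * (y * istar y)"
    by (rule idempotents_commute) (metis mult.assoc mult_istar_mult)+
  have "x * y * (istar y * istar x) * (x * y) = x * (y * istar y * (istar x * x)) * y"
    by (simp add: mult.assoc)
  also have "\<dots> = (x * istar x * x) * (y * istar y * y)"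
    unfolding c by (simp add: mult.assoc)
  finally have 1: "x * y * (istar y * istar x) * (x * y) = x * y"
    by (simp add: mult_istar_mult)
  have "istar y * istar x * (x * y) * (istar y * istar x)
      = istar y * (istar x * x * (y * istar y)) * istar x"
    by (simp add: mult.assoc)
  also have "\<dots> = (istar y * y * istar y) * (istar x * x * istar x)"
    unfolding c[symmetric] by (simp add: mult.assoc)
  finally have "istar y * istar x * (x * y) * (istar y * istar x) = istar y * istar x"
    by (simp add: istar_mult_istar)
  then show ?thesis using istar_unique[OF 1] by simp
qed

lemma bij_istar: "bij (istar :: 'p::inverse_semigroup \<Rightarrow> 'p)"
  by (rule o_bij[of istar]) (auto simp: istar_istar fun_eq_iff)

lemma l1_star_l1: "f \<in> l1 \<Longrightarrow> l1_star f \<in> l1"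
  using l1_cnj[OF l1_reindex[OF bij_istar]] by (simp add: l1_star_def)

text \<open>The image of \<open>istar x\<close> satisfies the equations of the inverse of
  \<open>\<psi> x\<close>, so compatibility with the involution comes from multiplicativity
  alone.\<close>

lemma hom_istar:
  fixes \<psi> :: "'p::inverse_semigroup \<Rightarrow> 'q::inverse_semigroup"
  assumes "\<And>x y. \<psi> (x * y) = \<psi> x * \<psi> y"
  shows "\<psi> (istar x) = istar (\<psi> x)"
  by (metis assms istar_unique mult_istar_mult istar_mult_istar)

text \<open>Multiplicativity says that \<open>\<psi>\<close> after multiplication equals
  multiplication after \<open>map_prod \<psi> \<psi>\<close>; apply functoriality of
  \<open>push\<close> to both composites.\<close>

lemma push_convolution:
  fixes \<psi> :: "'p::inverse_semigroup \<Rightarrow> 'q::inverse_semigroup"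
  assumes "\<And>x y. \<psi> (x * y) = \<psi> x * \<psi> y" "f \<in> l1" "g \<in> l1"
  shows "push \<psi> (convolution f g) = convolution (push \<psi> f) (push \<psi> g)"
proof -
  have "\<psi> \<circ> (\<lambda>(s, t). s * t) = (\<lambda>(s, t). s * t) \<circ> map_prod \<psi> \<psi>"
    by (auto simp: assms(1))
  then show ?thesis
    by (simp add: convolution_eq_push push_push l1_tensor assms(2,3) flip: push_tensor)
qed

text \<open>The involution maps the fibre over \<open>q\<close> bijectively onto the fibre over
  \<open>istar q\<close>.\<close>

lemma push_l1_star:
  fixes \<psi> :: "'p::inverse_semigroup \<Rightarrow> 'q::inverse_semigroup"
  assumes "\<And>x y. \<psi> (x * y) = \<psi> x * \<psi> y"
  shows "push \<psi> (l1_star f) = l1_star (push \<psi> f)"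
proof
  fix q
  have "bij_betw istar {p. \<psi> p = q} {p. \<psi> p = istar q}"
    by (rule bij_betwI[where g=istar]) (auto simp: hom_istar[of \<psi>] assms istar_istar)
  then show "push \<psi> (l1_star f) q = l1_star (push \<psi> f) q"
    by (simp add: push_def l1_star_def flip: infsum_reindex_bij_betw[where g=istar and f=f])
qed

section \<open>Hilbert spaces\<close>

locale hilbert =
  fixes H :: "'h hspace"
  assumes hilbert_space: "hilbert_space H"
begin

abbreviation "V \<equiv> hvecs H"
abbreviation "ip \<equiv> hinner H"
abbreviation "vadd \<equiv> hadd H"
abbreviation "scl \<equiv> hscale H"
abbreviation "nrm \<equiv> hnorm H"
abbreviation "vsub x y \<equiv> vadd x (scl (-1) y)"

lemma vector_space: "complex_vector_space H" and inner_product: "complex_inner_product H"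
  and complete: "hcomplete H"
  using hilbert_space by (simp_all add: hilbert_space_def)

lemma zero_in [simp]: "hzero H \<in> V"
  and add_in [simp]: "x \<in> V \<Longrightarrow> y \<in> V \<Longrightarrow> vadd x y \<in> V"
  and scale_in [simp]: "x \<in> V \<Longrightarrow> scl a x \<in> V"
  and add_assoc: "x \<in> V \<Longrightarrow> y \<in> V \<Longrightarrow> z \<in> V \<Longrightarrow> vadd (vadd x y) z = vadd x (vadd y z)"
  and add_commute: "x \<in> V \<Longrightarrow> y \<in> V \<Longrightarrow> vadd x y = vadd y x"
  and add_zero_left: "x \<in> V \<Longrightarrow> vadd (hzero H) x = x"
  and sub_self: "x \<in> V \<Longrightarrow> vsub x x = hzero H"
  and scale_add_right: "x \<in> V \<Longrightarrow> y \<in> V \<Longrightarrow> scl a (vadd x y) = vadd (scl a x) (scl a y)"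
  and scale_add_left: "x \<in> V \<Longrightarrow> scl (a + b) x = vadd (scl a x) (scl b x)"
  and scale_scale: "x \<in> V \<Longrightarrow> scl (a * b) x = scl a (scl b x)"
  and scale_one: "x \<in> V \<Longrightarrow> scl 1 x = x"
  using vector_space unfolding complex_vector_space_def by (elim conjE; metis)+

lemma ip_add_left [simp]: "x \<in> V \<Longrightarrow> y \<in> V \<Longrightarrow> z \<in> V \<Longrightarrow> ip (vadd x y) z = ip x z + ip y z"
  and ip_scale_left [simp]: "x \<in> V \<Longrightarrow> y \<in> V \<Longrightarrow> ip (scl a x) y = a * ip x y"
  and ip_commute: "x \<in> V \<Longrightarrow> y \<in> V \<Longrightarrow> ip y x = cnj (ip x y)"
  and ip_pos: "x \<in> V \<Longrightarrow> x \<noteq> hzero H \<Longrightarrow> Re (ip x x) > 0"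
  using inner_product unfolding complex_inner_product_def by (elim conjE; metis)+

lemma ip_add_right [simp]: "x \<in> V \<Longrightarrow> y \<in> V \<Longrightarrow> z \<in> V \<Longrightarrow> ip z (vadd x y) = ip z x + ip z y"
  using ip_commute[of z "vadd x y"] ip_commute[of z x] ip_commute[of z y]
  by (metis add_in complex_cnj_add complex_cnj_cnj ip_add_left)

lemma ip_scale_right [simp]: "x \<in> V \<Longrightarrow> y \<in> V \<Longrightarrow> ip y (scl a x) = cnj a * ip y x"
  using ip_commute[of y "scl a x"] ip_commute[of y x]
  by (metis scale_in complex_cnj_mult complex_cnj_cnj ip_scale_left)

lemma ip_zero_left [simp]:
  assumes "z \<in> V" shows "ip (hzero H) z = 0"
proof -
  have "ip (hzero H) z + ip (hzero H) z = ip (hzero H) z"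
    using ip_add_left[of "hzero H" "hzero H" z] add_zero_left[of "hzero H"] assms zero_in by metis
  then show ?thesis by simp
qed

lemma ip_zero_right [simp]: "z \<in> V \<Longrightarrow> ip z (hzero H) = 0"
  by (subst ip_commute[of "hzero H" z]) auto

lemma eq_if_ip_sub_eq_0:
  assumes x: "x \<in> V" and y: "y \<in> V" and "ip (vsub x y) (vsub x y) = 0"
  shows "x = y"
proof -
  have d: "vsub x y = hzero H"
    using ip_pos[of "vsub x y"] assms by force
  let ?m = "scl (-1) y"
  have "x = vadd (vsub y y) x"
    using x y by (simp add: sub_self add_zero_left)
  also have "\<dots> = vadd y (vadd ?m x)"
    using x y by (simp add: add_assoc)
  also have "\<dots> = vadd (hzero H) y"
    using x y by (simp add: add_commute[of ?m x] d add_commute)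
  finally show ?thesis
    using y by (simp add: add_zero_left)
qed

lemma ip_ext:
  assumes x: "x \<in> V" and y: "y \<in> V" and eq: "\<And>z. z \<in> V \<Longrightarrow> ip x z = ip y z"
  shows "x = y"
  using x y eq[OF x] eq[OF y] by (intro eq_if_ip_sub_eq_0) (simp_all add: algebra_simps)

lemma ip_self_nonneg: "x \<in> V \<Longrightarrow> 0 \<le> Re (ip x x)"
  using ip_pos[of x] by (cases "x = hzero H") auto

lemma norm_nonneg [simp]: "x \<in> V \<Longrightarrow> 0 \<le> nrm x"
  by (simp add: hnorm_def ip_self_nonneg)

lemma norm_square: "x \<in> V \<Longrightarrow> (nrm x)\<^sup>2 = Re (ip x x)"
  by (simp add: hnorm_def ip_self_nonneg)

lemma ip_self:
  assumes "x \<in> V" shows "ip x x = of_real ((nrm x)\<^sup>2)"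
proof -
  have "Im (ip x x) = - Im (ip x x)"
    using ip_commute[OF assms assms] by (metis cnj.simps(2))
  then have "Im (ip x x) = 0" by linarith
  then show ?thesis
    using assms by (simp add: norm_square complex_eq_iff)
qed

lemma norm_zero [simp]: "nrm (hzero H) = 0"
  by (simp add: hnorm_def)

lemma norm_eq_0: "x \<in> V \<Longrightarrow> nrm x = 0 \<longleftrightarrow> x = hzero H"
  using ip_pos[of x] norm_square[of x] by fastforce

lemma norm_scale [simp]:
  assumes "x \<in> V" shows "nrm (scl a x) = cmod a * nrm x"
proof -
  have "ip (scl a x) (scl a x) = (a * cnj a) * ip x x"
    using assms by simp
  also have "\<dots> = of_real ((cmod a)\<^sup>2 * (nrm x)\<^sup>2)"
    by (simp only: complex_norm_square[symmetric] ip_self[OF assms] of_real_mult)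
  finally have "ip (scl a x) (scl a x) = of_real ((cmod a)\<^sup>2 * (nrm x)\<^sup>2)" .
  then have "(nrm (scl a x))\<^sup>2 = (cmod a * nrm x)\<^sup>2"
    using norm_square[of "scl a x"] assms by (simp add: power_mult_distrib)
  then show ?thesis
    using assms by (simp add: power2_eq_iff_nonneg)
qed

lemma Cauchy_Schwarz:
  assumes x: "x \<in> V" and y: "y \<in> V" shows "cmod (ip x y) \<le> nrm x * nrm y"
proof (cases "y = hzero H")
  case False
  then have pos: "nrm y > 0"
    using norm_eq_0[OF y] norm_nonneg[OF y] by linarith
  \<comment> \<open>The multiple \<open>t\<close> of \<open>y\<close> is the projection of
    \<open>x\<close> to the line through \<open>y\<close>; the inequality is the nonnegativity of
    the squared norm of the remainder \<open>?w\<close>.\<close>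
  define t where "t = ip x y / of_real ((nrm y)\<^sup>2)"
  have tc: "t * of_real ((nrm y)\<^sup>2) = ip x y"
    using pos by (simp add: t_def)
  let ?w = "vadd x (scl (- t) y)"
  have "ip ?w ?w = ip x x - cnj t * ip x y - t * ip y x + cnj t * (t * ip y y)"
    using x y by (simp add: algebra_simps)
  also have "t * ip y y = ip x y"
    using tc ip_self[OF y] by simp
  also have "t * ip y x = of_real ((cmod (ip x y))\<^sup>2 / (nrm y)\<^sup>2)"
    by (simp only: t_def ip_commute[OF x y] of_real_divide complex_norm_square times_divide_eq_left)
  finally have eq: "ip ?w ?w = of_real ((nrm x)\<^sup>2 - (cmod (ip x y))\<^sup>2 / (nrm y)\<^sup>2)"
    by (simp add: ip_self[OF x])
  have "0 \<le> Re (ip ?w ?w)"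
    using x y by (intro ip_self_nonneg) simp
  then have "(cmod (ip x y))\<^sup>2 / (nrm y)\<^sup>2 \<le> (nrm x)\<^sup>2"
    unfolding eq by simp
  then have "(cmod (ip x y))\<^sup>2 \<le> (nrm x * nrm y)\<^sup>2"
    using pos by (simp add: divide_le_eq power_mult_distrib)
  then show ?thesis
    using x y by (simp add: power2_le_iff_abs_le)
qed (use x in simp)

text \<open>Test with \<open>z = x\<close>. Vectors are mostly known only through their inner
  products below, and this converts weak estimates into norm estimates.\<close>

lemma norm_le:
  assumes x: "x \<in> V" and c: "0 \<le> c" and le: "\<And>z. z \<in> V \<Longrightarrow> cmod (ip x z) \<le> c * nrm z"
  shows "nrm x \<le> c"
proof (cases "nrm x = 0")
  case False
  have "nrm x * nrm x \<le> c * nrm x"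
    using le[OF x] ip_self[OF x] by (simp add: norm_mult power2_eq_square)
  then show ?thesis
    using False norm_nonneg[OF x] by (simp add: mult_le_cancel_right)
qed (use c in simp)

lemma norm_add:
  assumes "x \<in> V" "y \<in> V" shows "nrm (vadd x y) \<le> nrm x + nrm y"
proof (rule norm_le)
  fix z assume z: "z \<in> V"
  have "cmod (ip (vadd x y) z) \<le> cmod (ip x z) + cmod (ip y z)"
    using assms z by (simp add: norm_triangle_ineq)
  also have "\<dots> \<le> (nrm x + nrm y) * nrm z"
    using Cauchy_Schwarz assms z by (simp add: distrib_right add_mono)
  finally show "cmod (ip (vadd x y) z) \<le> (nrm x + nrm y) * nrm z" .
qed (use assms in auto)

lemma tendsto_ip:
  assumes X: "\<And>n. X n \<in> V" and x: "x \<in> V" and z: "z \<in> V"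
    and lim: "(\<lambda>n. hdist H (X n) x) \<longlonglongrightarrow> 0"
  shows "(\<lambda>n. ip (X n) z) \<longlonglongrightarrow> ip x z"
proof -
  have "cmod (ip (X n) z - ip x z) \<le> hdist H (X n) x * nrm z" for n
    using Cauchy_Schwarz[of "vsub (X n) x" z] X x z by (simp add: hdist_def)
  moreover have "(\<lambda>n. hdist H (X n) x * nrm z) \<longlonglongrightarrow> 0"
    using tendsto_mult_right[OF lim, of "nrm z"] by simp
  ultimately have "(\<lambda>n. ip (X n) z - ip x z) \<longlonglongrightarrow> 0"
    by (rule Lim_null_comparison[OF always_eventually[OF allI]])
  then show ?thesis
    by (simp add: LIM_zero_iff)
qed

lemma finite_weak_sum:
  assumes "finite F" "\<And>p. g p \<in> V"
  shows "\<exists>y\<in>V. \<forall>z\<in>V. ip y z = (\<Sum>p\<in>F. f p * ip (g p) z)"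
  using assms(1)
proof (induction F)
  case empty
  then show ?case by (intro bexI[of _ "hzero H"]) auto
next
  case (insert p F)
  then obtain y where "y \<in> V" "\<forall>z\<in>V. ip y z = (\<Sum>p\<in>F. f p * ip (g p) z)" by blast
  then show ?case
    using insert.hyps assms(2) by (intro bexI[of _ "vadd (scl (f p) (g p)) y"]) auto
qed

lemma summable_ip:
  assumes "f \<in> l1" "\<And>p. g p \<in> V" "\<And>p. nrm (g p) \<le> C" "z \<in> V"
  shows "(\<lambda>p. f p * ip (g p) z) \<in> l1"
proof (rule l1_mult_bounded[OF assms(1)])
  show "cmod (ip (g p) z) \<le> C * nrm z" for p
    using Cauchy_Schwarz[of "g p" z] assms by (meson mult_right_mono norm_nonneg order_trans)
qed

text \<open>Norm convergence of an absolutely convergent series: the partial sums over finite sets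
  \<open>F n\<close>, which miss at most \<open>1/(n+1)\<close> of the total mass of
  \<open>f\<close>, form a Cauchy sequence, and its limit has the required inner products.\<close>

lemma weak_sum:
  assumes f: "f \<in> l1" and g: "\<And>p. g p \<in> V" and C: "\<And>p. nrm (g p) \<le> C"
  shows "\<exists>y\<in>V. \<forall>z\<in>V. ip y z = (\<Sum>\<^sub>\<infinity>p. f p * ip (g p) z)"
proof -
  have C0: "0 \<le> C"
    using norm_nonneg[OF g] C by (meson order_trans)
  have abs: "(\<lambda>p. cmod (f p)) summable_on UNIV"
    using f by (simp add: l1_def)
  have "\<exists>F. finite F \<and> dist (sum (\<lambda>p. cmod (f p)) F) (\<Sum>\<^sub>\<infinity>p. cmod (f p)) \<le> inverse (real (Suc n))" for n
    using infsum_finite_approximation[OF abs, of "inverse (real (Suc n))"] by auto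
  then obtain F where fin: "\<And>n. finite (F n)" and
    F: "\<And>n. dist (sum (\<lambda>p. cmod (f p)) (F n)) (\<Sum>\<^sub>\<infinity>p. cmod (f p)) \<le> inverse (real (Suc n))"
    by metis
  have tail: "(\<Sum>\<^sub>\<infinity>p\<in>-F n. cmod (f p)) \<le> inverse (real (Suc n))" for n
    using infsum_Un_disjoint[of "\<lambda>p. cmod (f p)" "F n" "-F n"] F[of n] fin[of n] abs
    by (auto simp: dist_real_def Compl_partition summable_on_subset_banach)
  have "\<forall>n. \<exists>x. x \<in> V \<and> (\<forall>z\<in>V. ip x z = (\<Sum>p\<in>F n. f p * ip (g p) z))"
    using finite_weak_sum[where g=g and f=f, OF fin g] by blast
  from choice[OF this] obtain X where X: "\<And>n. X n \<in> V"
    and ipX: "\<And>n z. z \<in> V \<Longrightarrow> ip (X n) z = (\<Sum>p\<in>F n. f p * ip (g p) z)"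
    by blast
  \<comment> \<open>The bound is linear in \<open>nrm z\<close>. Hence \<open>norm_le\<close> turns
    it into a Cauchy estimate in norm, and for fixed \<open>z\<close> it identifies the limit of the
    inner products.\<close>
  have diff: "cmod (ip (X n) z - (\<Sum>\<^sub>\<infinity>p. f p * ip (g p) z)) \<le> inverse (real (Suc n)) * (C * nrm z)"
    if z: "z \<in> V" for n z
  proof -
    have h: "(\<lambda>p. f p * ip (g p) z) \<in> l1"
      by (rule summable_ip[OF f g C z])
    have "(\<Sum>\<^sub>\<infinity>p. f p * ip (g p) z) - ip (X n) z = (\<Sum>\<^sub>\<infinity>p\<in>-F n. f p * ip (g p) z)"
      using infsum_Un_disjoint[of "\<lambda>p. f p * ip (g p) z" "F n" "-F n"] fin[of n] h z
      by (simp add: ipX Compl_partition l1_summable_on)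
    also have "cmod \<dots> \<le> (\<Sum>\<^sub>\<infinity>p\<in>-F n. cmod (f p) * (C * nrm z))"
    proof (rule norm_infsum_le[OF has_sum_infsum has_sum_infsum])
      show "cmod (f p * ip (g p) z) \<le> cmod (f p) * (C * nrm z)" for p
        using Cauchy_Schwarz[OF g z, of p] C[of p] z
        by (simp add: norm_mult mult_left_mono order_trans[OF _ mult_right_mono])
      show "(\<lambda>p. f p * ip (g p) z) summable_on - F n"
        by (rule l1_summable_on[OF h])
      show "(\<lambda>p. cmod (f p) * (C * nrm z)) summable_on - F n"
        by (intro summable_on_cmult_left summable_on_subset_banach[OF abs]) simp
    qed
    also have "\<dots> \<le> inverse (real (Suc n)) * (C * nrm z)"
      using tail[of n] C0 z by (simp add: infsum_cmult_left' mult_right_mono)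
    finally show ?thesis
      by (simp add: norm_minus_commute)
  qed
  have dist: "hdist H (X m) (X n) \<le> C * (inverse (real (Suc m)) + inverse (real (Suc n)))" for m n
    unfolding hdist_def
  proof (rule norm_le)
    fix z assume z: "z \<in> V"
    let ?s = "\<Sum>\<^sub>\<infinity>p. f p * ip (g p) z"
    have "ip (vsub (X m) (X n)) z = (ip (X m) z - ?s) - (ip (X n) z - ?s)"
      using X z by simp
    also have "cmod \<dots> \<le> cmod (ip (X m) z - ?s) + cmod (ip (X n) z - ?s)"
      by (rule norm_triangle_ineq4)
    also have "\<dots> \<le> C * (inverse (real (Suc m)) + inverse (real (Suc n))) * nrm z"
      using diff[OF z, of m] diff[OF z, of n] by (simp add: algebra_simps)
    finally show "cmod (ip (vsub (X m) (X n)) z)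
      \<le> C * (inverse (real (Suc m)) + inverse (real (Suc n))) * nrm z" .
  qed (use X C0 in auto)
  have "\<exists>M. \<forall>m\<ge>M. \<forall>n\<ge>M. hdist H (X m) (X n) < e" if "e > 0" for e
  proof -
    have "(\<lambda>n. C * (inverse (real (Suc n)) + inverse (real (Suc n)))) \<longlonglongrightarrow> C * (0 + 0)"
      by (intro tendsto_intros LIMSEQ_inverse_real_of_nat)
    then obtain M where M: "C * (inverse (real (Suc M)) + inverse (real (Suc M))) < e"
      using order_tendstoD(2)[of _ "C * (0 + 0)" sequentially e] \<open>e > 0\<close>
      by (auto simp: eventually_sequentially)
    have "hdist H (X m) (X n) < e" if "m \<ge> M" "n \<ge> M" for m n
    proof -
      have "inverse (real (Suc m)) \<le> inverse (real (Suc M))" "inverse (real (Suc n)) \<le> inverse (real (Suc M))"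
        using that by (auto intro: le_imp_inverse_le)
      then show ?thesis
        using dist[of m n] M mult_left_mono[OF _ C0] by (smt (verit))
    qed
    then show ?thesis by blast
  qed
  then obtain y where y: "y \<in> V" and lim: "(\<lambda>n. hdist H (X n) y) \<longlonglongrightarrow> 0"
    using complete X unfolding hcomplete_def by blast
  have "ip y z = (\<Sum>\<^sub>\<infinity>p. f p * ip (g p) z)" if z: "z \<in> V" for z
  proof (rule LIMSEQ_unique[OF tendsto_ip[OF X y z lim]])
    have "(\<lambda>n. inverse (real (Suc n)) * (C * nrm z)) \<longlonglongrightarrow> 0"
      using tendsto_mult_right[OF LIMSEQ_inverse_real_of_nat, of "C * nrm z"] by simp
    then have "(\<lambda>n. ip (X n) z - (\<Sum>\<^sub>\<infinity>p. f p * ip (g p) z)) \<longlonglongrightarrow> 0"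
      by (rule Lim_null_comparison[OF always_eventually[OF allI[OF diff[OF z]]]])
    then show "(\<lambda>n. ip (X n) z) \<longlonglongrightarrow> (\<Sum>\<^sub>\<infinity>p. f p * ip (g p) z)"
      by (simp add: LIM_zero_iff)
  qed
  then show ?thesis using y by blast
qed

text \<open>Applied twice to a subset of \<open>V\<close> it produces the closed linear span,
  without recourse to closures or linear combinations.\<close>

definition orth :: "'h set \<Rightarrow> 'h set" where
  "orth W = {y \<in> V. \<forall>w\<in>W. ip y w = 0}"

lemma hilbert_space_orth:
  assumes W: "W \<subseteq> V" shows "hilbert_space (H\<lparr>hvecs := orth W\<rparr>)"
proof -
  have sub: "orth W \<subseteq> V" by (auto simp: orth_def)
  have "complex_vector_space (H\<lparr>hvecs := orth W\<rparr>)"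
  proof -
    have "hzero H \<in> orth W" "\<And>a x. x \<in> orth W \<Longrightarrow> scl a x \<in> orth W"
      "\<And>x y. x \<in> orth W \<Longrightarrow> y \<in> orth W \<Longrightarrow> vadd x y \<in> orth W"
      using W by (auto simp: orth_def subset_iff)
    then show ?thesis
      using sub unfolding complex_vector_space_def
      by (simp add: subset_iff add_assoc add_zero_left sub_self scale_add_right scale_add_left
          scale_scale scale_one) (simp add: add_commute)
  qed
  moreover have "complex_inner_product (H\<lparr>hvecs := orth W\<rparr>)"
    using sub unfolding complex_inner_product_def
    by (intro conjI) (auto simp: subset_iff ip_pos intro!: ip_commute)
  moreover have "hcomplete (H\<lparr>hvecs := orth W\<rparr>)"
  proof -
    have dist: "hdist (H\<lparr>hvecs := orth W\<rparr>) = hdist H"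
      by (simp add: hdist_def hnorm_def fun_eq_iff)
    have "\<exists>x\<in>orth W. (\<lambda>n. hdist H (X n) x) \<longlonglongrightarrow> 0"
      if X: "\<And>n. X n \<in> orth W" and cauchy: "\<forall>e>0. \<exists>M. \<forall>m\<ge>M. \<forall>n\<ge>M. hdist H (X m) (X n) < e"
      for X :: "nat \<Rightarrow> 'h"
    proof -
      have XV: "X n \<in> V" for n using X sub by blast
      obtain x where x: "x \<in> V" and lim: "(\<lambda>n. hdist H (X n) x) \<longlonglongrightarrow> 0"
        using complete cauchy XV unfolding hcomplete_def by blast
      \<comment> \<open>Closedness: inner products with a fixed \<open>w\<close> pass to the limit,
        and here they are all zero.\<close>
      have "ip x w = 0" if "w \<in> W" for w
        using tendsto_ip[OF XV x _ lim, of w] X that W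
        by (auto simp: orth_def LIMSEQ_const_iff)
      then show ?thesis using x lim by (auto simp: orth_def)
    qed
    then show ?thesis unfolding hcomplete_def by (auto simp: dist)
  qed
  ultimately show ?thesis by (simp add: hilbert_space_def)
qed

end

section \<open>Transport of Hilbert space structure along an injection\<close>

definition transport :: "('h \<Rightarrow> 'k) \<Rightarrow> 'h hspace \<Rightarrow> 'k hspace" where
  "transport J H = (let j = the_inv_into (hvecs H) J in
     \<lparr>hvecs = J ` hvecs H, hzero = J (hzero H), hadd = (\<lambda>a b. J (hadd H (j a) (j b))),
      hscale = (\<lambda>c a. J (hscale H c (j a))), hinner = (\<lambda>a b. hinner H (j a) (j b))\<rparr>)"

lemma transport_simps:
  assumes "inj_on J (hvecs H)"
  shows "hvecs (transport J H) = J ` hvecs H" "hzero (transport J H) = J (hzero H)"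
    "x \<in> hvecs H \<Longrightarrow> y \<in> hvecs H \<Longrightarrow> hadd (transport J H) (J x) (J y) = J (hadd H x y)"
    "x \<in> hvecs H \<Longrightarrow> hscale (transport J H) c (J x) = J (hscale H c x)"
    "x \<in> hvecs H \<Longrightarrow> y \<in> hvecs H \<Longrightarrow> hinner (transport J H) (J x) (J y) = hinner H x y"
    "x \<in> hvecs H \<Longrightarrow> hnorm (transport J H) (J x) = hnorm H x"
  using assms by (simp_all add: transport_def Let_def the_inv_into_f_f hnorm_def)

text \<open>Moves a Hilbert space to another type of vectors, as required by the fixed vector type
  in \<open>full_norm\<close>. All axioms carry over because \<open>J\<close> intertwines the
  operations and preserves inner products.\<close>

lemma hilbert_space_transport:
  assumes "hilbert_space H" and inj: "inj_on J (hvecs H)"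
  shows "hilbert_space (transport J H)"
proof -
  interpret hilbert H by standard (rule assms(1))
  note [simp] = transport_simps[OF inj]
  have "complex_vector_space (transport J H)"
    unfolding complex_vector_space_def
    by (simp add: add_assoc add_zero_left sub_self scale_add_right scale_add_left
        scale_scale scale_one) (simp add: add_commute)
  moreover have "complex_inner_product (transport J H)"
    unfolding complex_inner_product_def
    by (intro conjI) (auto simp: inj_on_eq_iff[OF inj] ip_pos intro!: ip_commute)
  moreover have "hcomplete (transport J H)"
  proof -
    have dist: "hdist (transport J H) (J x) (J y) = hdist H x y" if "x \<in> V" "y \<in> V" for x y
      using that by (simp add: hdist_def)
    have "\<exists>x\<in>J ` V. (\<lambda>n. hdist (transport J H) (X n) x) \<longlonglongrightarrow> 0"
      if X: "\<forall>n. X n \<in> J ` V"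
        and cauchy: "\<forall>e>0. \<exists>M. \<forall>m\<ge>M. \<forall>n\<ge>M. hdist (transport J H) (X m) (X n) < e"
      for X :: "nat \<Rightarrow> 'b"
    proof -
      obtain Y where Y: "\<And>n. Y n \<in> V" and XY: "X = (\<lambda>n. J (Y n))"
        using X by (metis image_iff ext)
      have "\<forall>e>0. \<exists>M. \<forall>m\<ge>M. \<forall>n\<ge>M. hdist H (Y m) (Y n) < e"
        using cauchy by (simp add: XY dist Y)
      then obtain y where y: "y \<in> V" "(\<lambda>n. hdist H (Y n) y) \<longlonglongrightarrow> 0"
        using complete Y unfolding hcomplete_def by blast
      then show ?thesis
        by (intro bexI[of _ "J y"]) (auto simp: XY dist Y)
    qed
    then show ?thesis unfolding hcomplete_def by auto
  qed
  ultimately show ?thesis by (simp add: hilbert_space_def)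
qed

section \<open>Integrated forms and the full norm\<close>

context hilbert
begin

lemma op_norm_le:
  assumes "0 \<le> c" "\<And>x. x \<in> V \<Longrightarrow> nrm (T x) \<le> c * nrm x"
  shows "op_norm H T \<le> c"
  unfolding op_norm_def
proof (rule cSup_least)
  show "{nrm (T x) |x. x \<in> V \<and> nrm x \<le> 1} \<noteq> {}"
    using zero_in norm_zero by (auto intro!: exI[of _ "hzero H"])
  fix r assume "r \<in> {nrm (T x) |x. x \<in> V \<and> nrm x \<le> 1}"
  then obtain x where x: "x \<in> V" "nrm x \<le> 1" "r = nrm (T x)" by blast
  then show "r \<le> c"
    using assms(2)[of x] mult_left_mono[OF x(2) assms(1)] by simp
qed

text \<open>\<open>op_norm\<close> is a supremum of reals, which is an upper bound only of a set
  bounded above; the constant \<open>c\<close> supplies this a priori bound.\<close>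

lemma norm_le_op_norm_unit:
  assumes "0 \<le> c" "\<And>x. x \<in> V \<Longrightarrow> nrm (T x) \<le> c * nrm x" "x \<in> V" "nrm x \<le> 1"
  shows "nrm (T x) \<le> op_norm H T"
  unfolding op_norm_def
proof (rule cSup_upper)
  show "bdd_above {nrm (T x) |x. x \<in> V \<and> nrm x \<le> 1}"
  proof (rule bdd_aboveI[of _ c], clarify)
    fix x assume x: "x \<in> V" "nrm x \<le> 1"
    then show "nrm (T x) \<le> c"
      using assms(2)[of x] mult_left_mono[OF x(2) assms(1)] by simp
  qed
qed (use assms in blast)

lemma op_norm_nonneg:
  assumes "0 \<le> c" "\<And>x. x \<in> V \<Longrightarrow> nrm (T x) \<le> c * nrm x" "T (hzero H) \<in> V"
  shows "0 \<le> op_norm H T"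
  using norm_le_op_norm_unit[of c T "hzero H"] assms(1,2) norm_nonneg[OF assms(3)]
  by (auto intro: order_trans)

lemma norm_le_op_norm:
  assumes "0 \<le> c" "\<And>x. x \<in> V \<Longrightarrow> nrm (T x) \<le> c * nrm x"
    and T: "\<And>x. x \<in> V \<Longrightarrow> T x \<in> V" and lin: "\<And>a x. x \<in> V \<Longrightarrow> T (scl a x) = scl a (T x)"
    and x: "x \<in> V"
  shows "nrm (T x) \<le> op_norm H T * nrm x"
proof (cases "nrm x = 0")
  case True
  then show ?thesis using assms(2)[OF x] by simp
next
  case False
  then have pos: "0 < nrm x" using norm_nonneg[OF x] by linarith
  have "nrm (T (scl (of_real (inverse (nrm x))) x)) \<le> op_norm H T"
    using pos x by (intro norm_le_op_norm_unit[OF assms(1,2)]) (auto simp: norm_inverse)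
  then have "inverse (nrm x) * nrm (T x) \<le> op_norm H T"
    using pos x T by (simp add: lin norm_inverse)
  then show ?thesis
    using pos by (simp add: field_simps)
qed

end

locale rep = hilbert H for H :: "'h hspace" +
  fixes Z :: "'p::inverse_semigroup set" and \<pi> :: "'p \<Rightarrow> 'h \<Rightarrow> 'h"
  assumes star_rep: "star_representation Z H \<pi>"
begin

abbreviation "A \<equiv> integrated_form H \<pi>"

lemma bounded_rep: "bounded_operator H (\<pi> s)"
  and rep_mult: "x \<in> V \<Longrightarrow> \<pi> (s * t) x = \<pi> s (\<pi> t x)"
  and rep_adjoint: "x \<in> V \<Longrightarrow> y \<in> V \<Longrightarrow> ip (\<pi> (istar s) x) y = ip x (\<pi> s y)"
  and rep_zero: "z \<in> Z \<Longrightarrow> x \<in> V \<Longrightarrow> \<pi> z x = hzero H"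
  using star_rep unfolding star_representation_def by (elim conjE; metis)+

lemma rep_in [simp]: "x \<in> V \<Longrightarrow> \<pi> s x \<in> V"
  and rep_add: "x \<in> V \<Longrightarrow> y \<in> V \<Longrightarrow> \<pi> s (vadd x y) = vadd (\<pi> s x) (\<pi> s y)"
  and rep_scale: "x \<in> V \<Longrightarrow> \<pi> s (scl a x) = scl a (\<pi> s x)"
  using bounded_rep[of s] unfolding bounded_operator_def by (elim conjE; metis)+

lemma rep_adjoint': "x \<in> V \<Longrightarrow> y \<in> V \<Longrightarrow> ip (\<pi> s x) y = ip x (\<pi> (istar s) y)"
  using rep_adjoint[of x y "istar s"] by (simp add: istar_istar)

text \<open>With \<open>T = \<pi>(s)\<close> one has \<open>\<parallel>T\<^sup>*Tx\<parallel>\<^sup>2 = \<langle>Tx, TT\<^sup>*Tx\<rangle> = \<parallel>Tx\<parallel>\<^sup>2\<close>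
  and \<open>\<parallel>Tx\<parallel>\<^sup>2 = \<langle>T\<^sup>*Tx, x\<rangle> \<le> \<parallel>T\<^sup>*Tx\<parallel>\<parallel>x\<parallel>\<close>.\<close>

lemma rep_contraction:
  assumes x: "x \<in> V" shows "nrm (\<pi> s x) \<le> nrm x"
proof -
  let ?y = "\<pi> (istar s) (\<pi> s x)"
  have "\<pi> s ?y = \<pi> s x"
    using x mult_istar_mult[of s] by (metis rep_in rep_mult)
  then have "ip ?y ?y = ip (\<pi> s x) (\<pi> s x)"
    using x by (simp add: rep_adjoint)
  then have eq: "nrm ?y = nrm (\<pi> s x)"
    by (simp add: hnorm_def)
  have "(nrm (\<pi> s x))\<^sup>2 = cmod (ip (\<pi> s x) (\<pi> s x))"
    using x by (subst ip_self) (auto simp del: of_real_power)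
  also have "\<dots> = cmod (ip ?y x)"
    using x by (simp add: rep_adjoint)
  also have "\<dots> \<le> nrm (\<pi> s x) * nrm x"
    using Cauchy_Schwarz[of ?y x] x eq by simp
  finally have le: "nrm (\<pi> s x) * nrm (\<pi> s x) \<le> nrm (\<pi> s x) * nrm x"
    by (simp add: power2_eq_square)
  show ?thesis
  proof (cases "0 < nrm (\<pi> s x)")
    case True
    then show ?thesis using mult_left_le_imp_le[OF le] by simp
  next
    case False
    then show ?thesis using norm_nonneg[OF x] by linarith
  qed
qed

lemma rep_coefficient_bound:
  assumes "x \<in> V" "z \<in> V" shows "cmod (ip (\<pi> s x) z) \<le> nrm x * nrm z"
  using Cauchy_Schwarz[of "\<pi> s x" z] rep_contraction[of x s] assms
  by (meson mult_right_mono norm_nonneg order_trans rep_in)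

lemma summable_coefficients:
  assumes "f \<in> l1" "x \<in> V" "z \<in> V" shows "(\<lambda>p. f p * ip (\<pi> p x) z) \<in> l1"
  by (rule l1_mult_bounded[OF assms(1) rep_coefficient_bound[OF assms(2,3)]])

text \<open>Inner products determine a vector, which settles uniqueness in the definite description.
  Identities between integrated forms are proved below by checking the weak formula.\<close>

lemma integrated_form_eqI:
  assumes "y \<in> V" "\<And>z. z \<in> V \<Longrightarrow> ip y z = (\<Sum>\<^sub>\<infinity>p. f p * ip (\<pi> p x) z)"
  shows "A f x = y"
  unfolding integrated_form_def
  by (rule the_equality) (use assms in \<open>auto intro: ip_ext\<close>)

text \<open>The described vector exists: the orbit of \<open>x\<close> is bounded by
  \<open>nrm x\<close>, so \<open>weak_sum\<close> applies.\<close>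

lemma integrated_form_unique:
  assumes "f \<in> l1" "x \<in> V"
  shows "A f x \<in> V \<and> (\<forall>z\<in>V. ip (A f x) z = (\<Sum>\<^sub>\<infinity>p. f p * ip (\<pi> p x) z))"
proof -
  obtain y where "y \<in> V" "\<forall>z\<in>V. ip y z = (\<Sum>\<^sub>\<infinity>p. f p * ip (\<pi> p x) z)"
    using weak_sum[where g="\<lambda>p. \<pi> p x", OF assms(1) rep_in[OF assms(2)] rep_contraction[OF assms(2)]] by blast
  then show ?thesis
    using integrated_form_eqI[of y f x] by auto
qed

lemma integrated_form_in [simp]: "f \<in> l1 \<Longrightarrow> x \<in> V \<Longrightarrow> A f x \<in> V"
  and ip_integrated_form:
    "f \<in> l1 \<Longrightarrow> x \<in> V \<Longrightarrow> z \<in> V \<Longrightarrow> ip (A f x) z = (\<Sum>\<^sub>\<infinity>p. f p * ip (\<pi> p x) z)"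
  using integrated_form_unique by blast+

text \<open>The constant depends on \<open>f\<close> only. This uniformity over all representations
  bounds the suprema in \<open>op_norm\<close> and \<open>full_norm\<close>.\<close>

lemma integrated_form_bound:
  assumes f: "f \<in> l1" and x: "x \<in> V"
  shows "nrm (A f x) \<le> (\<Sum>\<^sub>\<infinity>p. cmod (f p)) * nrm x"
proof (rule norm_le)
  show "A f x \<in> V" using assms by simp
  show "0 \<le> (\<Sum>\<^sub>\<infinity>p. cmod (f p)) * nrm x"
    using x by (simp add: infsum_nonneg)
  fix z assume z: "z \<in> V"
  have "cmod (\<Sum>\<^sub>\<infinity>p. f p * ip (\<pi> p x) z) \<le> (\<Sum>\<^sub>\<infinity>p. cmod (f p) * (nrm x * nrm z))"
  proof (rule norm_infsum_le[OF has_sum_infsum has_sum_infsum])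
    show "(\<lambda>p. f p * ip (\<pi> p x) z) summable_on UNIV"
      by (rule l1_summable_on[OF summable_coefficients[OF f x z]])
    show "(\<lambda>p. cmod (f p) * (nrm x * nrm z)) summable_on UNIV"
      using f by (intro summable_on_cmult_left) (simp add: l1_def)
    show "cmod (f p * ip (\<pi> p x) z) \<le> cmod (f p) * (nrm x * nrm z)" for p
      by (simp add: norm_mult mult_left_mono rep_coefficient_bound[OF x z])
  qed
  then show "cmod (ip (A f x) z) \<le> (\<Sum>\<^sub>\<infinity>p. cmod (f p)) * nrm x * nrm z"
    by (simp add: ip_integrated_form f x z infsum_cmult_left' mult.assoc)
qed

lemma integrated_form_vector_scale:
  assumes "f \<in> l1" "x \<in> V" shows "A f (scl a x) = scl a (A f x)"
  by (rule integrated_form_eqI)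
    (use assms in \<open>simp_all add: ip_integrated_form rep_scale mult.left_commute[of _ a]
      infsum_cmult_right'\<close>)

lemma integrated_form_add:
  assumes "f \<in> l1" "g \<in> l1" "x \<in> V"
  shows "A (\<lambda>p. f p + g p) x = vadd (A f x) (A g x)"
proof (rule integrated_form_eqI)
  fix z assume z: "z \<in> V"
  show "ip (vadd (A f x) (A g x)) z = (\<Sum>\<^sub>\<infinity>p. (f p + g p) * ip (\<pi> p x) z)"
    using assms z
    by (simp add: ip_integrated_form distrib_right infsum_add l1_summable_on summable_coefficients)
qed (use assms in simp)

lemma integrated_form_scale:
  assumes "f \<in> l1" "x \<in> V" shows "A (\<lambda>p. c * f p) x = scl c (A f x)"
  by (rule integrated_form_eqI)
    (use assms in \<open>simp_all add: ip_integrated_form mult.assoc infsum_cmult_right'\<close>)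

text \<open>Fubini over pairs \<open>(s, t)\<close>: once \<open>\<pi> s\<close> is moved to the
  second argument, the inner sum over \<open>t\<close> is the weak formula for \<open>A g x\<close>
  tested against \<open>\<pi> (istar s) z\<close>.\<close>

lemma integrated_form_convolution:
  assumes f: "f \<in> l1" and g: "g \<in> l1" and x: "x \<in> V"
  shows "A (convolution f g) x = A f (A g x)"
proof (rule integrated_form_eqI)
  fix z assume z: "z \<in> V"
  let ?h = "\<lambda>(s, t). f s * g t" and ?c = "\<lambda>r. ip (\<pi> r x) z"
  have h: "(\<lambda>p. ?h p * ?c (case p of (s, t) \<Rightarrow> s * t)) \<in> l1"
    by (rule l1_mult_bounded[OF l1_tensor[OF f g] rep_coefficient_bound[OF x z]])
  have "(\<Sum>\<^sub>\<infinity>r. convolution f g r * ?c r) = (\<Sum>\<^sub>\<infinity>p. ?h p * ?c (case p of (s, t) \<Rightarrow> s * t))"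
    unfolding convolution_eq_push
    by (rule infsum_push_mult[OF l1_tensor[OF f g] rep_coefficient_bound[OF x z]])
  also have "\<dots> = (\<Sum>\<^sub>\<infinity>s. \<Sum>\<^sub>\<infinity>t. f s * (g t * ?c (s * t)))"
    using infsum_UNIV_Times[OF h] by (simp add: mult.assoc)
  also have "\<dots> = (\<Sum>\<^sub>\<infinity>s. f s * ip (A g x) (\<pi> (istar s) z))"
    using g x z by (simp add: infsum_cmult_right' ip_integrated_form rep_mult rep_adjoint')
  also have "\<dots> = ip (A f (A g x)) z"
    using f g x z by (simp add: ip_integrated_form[of f] rep_adjoint')
  finally show "ip (A f (A g x)) z = (\<Sum>\<^sub>\<infinity>r. convolution f g r * ?c r)" by simp
qed (use assms in simp)

text \<open>Reindex the series by the involution and move each operator to the other side of the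
  inner product.\<close>

lemma ip_integrated_form_star:
  assumes f: "f \<in> l1" and x: "x \<in> V" and z: "z \<in> V"
  shows "ip (A (l1_star f) x) z = ip x (A f z)"
proof -
  have "ip (A (l1_star f) x) z = (\<Sum>\<^sub>\<infinity>s. cnj (f (istar s)) * ip (\<pi> s x) z)"
    using ip_integrated_form[OF l1_star_l1[OF f] x z] by (simp add: l1_star_def)
  also have "\<dots> = (\<Sum>\<^sub>\<infinity>s. cnj (f s) * ip (\<pi> (istar s) x) z)"
    using infsum_reindex_bij_betw[OF bij_istar, of "\<lambda>s. cnj (f s) * ip (\<pi> (istar s) x) z"]
    by (simp add: istar_istar)
  also have "\<dots> = (\<Sum>\<^sub>\<infinity>s. cnj (f s * ip (\<pi> s z) x))"
    using x z ip_commute[of "\<pi> _ z" x] by (simp add: rep_adjoint)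
  also have "\<dots> = cnj (ip (A f z) x)"
    using f x z by (simp only: infsum_cnj ip_integrated_form)
  finally show ?thesis
    using ip_commute[of "A f z" x] f x z by simp
qed

lemma op_norm_integrated_form_le:
  assumes "f \<in> l1" shows "op_norm H (A f) \<le> (\<Sum>\<^sub>\<infinity>p. cmod (f p))"
  by (rule op_norm_le) (use assms integrated_form_bound in \<open>auto simp: infsum_nonneg\<close>)

lemma op_norm_integrated_form_nonneg:
  assumes "f \<in> l1" shows "0 \<le> op_norm H (A f)"
  by (rule op_norm_nonneg[OF _ integrated_form_bound[OF assms]])
    (use assms in \<open>auto simp: infsum_nonneg\<close>)

lemma norm_integrated_form_le_op_norm:
  assumes "f \<in> l1" "x \<in> V" shows "nrm (A f x) \<le> op_norm H (A f) * nrm x"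
  by (rule norm_le_op_norm[OF _ integrated_form_bound[OF assms(1)]])
    (use assms in \<open>auto simp: infsum_nonneg integrated_form_vector_scale\<close>)

end

section \<open>The full norm as a submultiplicative seminorm\<close>

lemma repI: "hilbert_space H \<Longrightarrow> star_representation Z H \<pi> \<Longrightarrow> rep H Z \<pi>"
  by (simp add: rep_def hilbert_def rep_axioms_def)

text \<open>The zero space represents every semigroup, whatever \<open>Z\<close> is. It makes the
  set in \<open>full_norm\<close> nonempty and the full norm nonnegative.\<close>

definition trivial_hspace :: "('p \<Rightarrow> complex) hspace" where
  "trivial_hspace = \<lparr>hvecs = {\<lambda>_. 0}, hzero = \<lambda>_. 0, hadd = \<lambda>_ _ _. 0, hscale = \<lambda>_ _ _. 0,
     hinner = \<lambda>_ _. 0\<rparr>"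

lemma hilbert_space_trivial: "hilbert_space trivial_hspace"
  by (auto simp: hilbert_space_def complex_vector_space_def complex_inner_product_def
      hcomplete_def trivial_hspace_def hdist_def hnorm_def)

lemma star_representation_trivial: "star_representation Z trivial_hspace (\<lambda>_ _ _. 0)"
  by (auto simp: star_representation_def bounded_operator_def trivial_hspace_def hnorm_def)

text \<open>Together with \<open>norm_le_full_norm\<close> this makes \<open>full_norm Z f\<close>
  the least nonnegative constant that works in all representations, so the seminorm estimates can be
  checked on one vector at a time.\<close>

lemma full_norm_le:
  fixes f :: "'p::inverse_semigroup \<Rightarrow> complex"
  assumes "0 \<le> c"
    and le: "\<And>(H :: ('p \<Rightarrow> complex) hspace) \<pi> x. rep H Z \<pi> \<Longrightarrow> x \<in> hvecs H \<Longrightarrow>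
      hnorm H (integrated_form H \<pi> f x) \<le> c * hnorm H x"
  shows "full_norm Z f \<le> c"
  unfolding full_norm_def
proof (rule cSup_least)
  show "{op_norm H (integrated_form H \<pi> f) | (H :: ('p \<Rightarrow> complex) hspace) \<pi>.
      hilbert_space H \<and> star_representation Z H \<pi>} \<noteq> {}"
    using hilbert_space_trivial star_representation_trivial by blast
next
  fix r assume "r \<in> {op_norm H (integrated_form H \<pi> f) | (H :: ('p \<Rightarrow> complex) hspace) \<pi>.
      hilbert_space H \<and> star_representation Z H \<pi>}"
  then obtain H :: "('p \<Rightarrow> complex) hspace" and \<pi> where
    r: "r = op_norm H (integrated_form H \<pi> f)" and rep: "rep H Z \<pi>"
    by (auto intro: repI)
  then show "r \<le> c"
    using hilbert.op_norm_le[of H c] rep.axioms(1) assms(1) le[OF rep] by blast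
qed

lemma op_norm_le_full_norm:
  fixes H :: "('p::inverse_semigroup \<Rightarrow> complex) hspace" and Z :: "'p set"
  assumes "rep H Z \<pi>" "f \<in> l1"
  shows "op_norm H (integrated_form H \<pi> f) \<le> full_norm Z f"
  unfolding full_norm_def
proof (rule cSup_upper)
  show "bdd_above {op_norm H (integrated_form H \<pi> f) | (H :: ('p \<Rightarrow> complex) hspace) \<pi>.
      hilbert_space H \<and> star_representation Z H \<pi>}"
    by (rule bdd_aboveI[of _ "\<Sum>\<^sub>\<infinity>p. cmod (f p)"])
      (use rep.op_norm_integrated_form_le[OF repI] assms(2) in blast)
qed (use assms in \<open>auto simp: rep_def hilbert_def rep_axioms_def\<close>)

lemma full_norm_nonneg:
  assumes "f \<in> l1" shows "0 \<le> full_norm Z f"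
  using op_norm_le_full_norm[OF repI[OF hilbert_space_trivial star_representation_trivial] assms]
    rep.op_norm_integrated_form_nonneg[OF repI[OF hilbert_space_trivial star_representation_trivial] assms]
  by (rule order_trans[rotated])

lemma norm_le_full_norm:
  fixes H :: "('p::inverse_semigroup \<Rightarrow> complex) hspace" and Z :: "'p set"
  assumes "rep H Z \<pi>" "f \<in> l1" "x \<in> hvecs H"
  shows "hnorm H (integrated_form H \<pi> f x) \<le> full_norm Z f * hnorm H x"
proof -
  interpret rep H Z \<pi> by fact
  show ?thesis
    using norm_integrated_form_le_op_norm[OF assms(2,3)]
      mult_right_mono[OF op_norm_le_full_norm[OF assms(1,2)] norm_nonneg[OF assms(3)]]
    by (rule order_trans)
qed

lemma full_norm_add:
  assumes "f \<in> l1" "g \<in> l1"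
  shows "full_norm Z (\<lambda>p. f p + g p) \<le> full_norm Z f + full_norm Z g"
proof (rule full_norm_le)
  fix H :: "('a \<Rightarrow> complex) hspace" and \<pi> x
  assume rep: "rep H Z \<pi>" and x: "x \<in> hvecs H"
  interpret rep H Z \<pi> by fact
  show "nrm (A (\<lambda>p. f p + g p) x) \<le> (full_norm Z f + full_norm Z g) * nrm x"
    using norm_add[of "A f x" "A g x"] norm_le_full_norm[OF rep _ x, of f]
      norm_le_full_norm[OF rep _ x, of g] assms x
    by (simp add: integrated_form_add distrib_right)
qed (use assms in \<open>simp add: full_norm_nonneg\<close>)

lemma full_norm_scale:
  assumes "f \<in> l1" shows "full_norm Z (\<lambda>p. c * f p) \<le> cmod c * full_norm Z f"
proof (rule full_norm_le)
  fix H :: "('a \<Rightarrow> complex) hspace" and \<pi> x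
  assume rep: "rep H Z \<pi>" and x: "x \<in> hvecs H"
  interpret rep H Z \<pi> by fact
  show "nrm (A (\<lambda>p. c * f p) x) \<le> cmod c * full_norm Z f * nrm x"
    using norm_le_full_norm[OF rep assms x] assms x
    by (simp add: integrated_form_scale mult_left_mono mult.assoc)
qed (use assms in \<open>simp add: full_norm_nonneg\<close>)

lemma full_norm_convolution:
  assumes "f \<in> l1" "g \<in> l1"
  shows "full_norm Z (convolution f g) \<le> full_norm Z f * full_norm Z g"
proof (rule full_norm_le)
  fix H :: "('a \<Rightarrow> complex) hspace" and \<pi> x
  assume rep: "rep H Z \<pi>" and x: "x \<in> hvecs H"
  interpret rep H Z \<pi> by fact
  have "nrm (A f (A g x)) \<le> full_norm Z f * nrm (A g x)"
    using assms x by (intro norm_le_full_norm[OF rep]) auto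
  also have "\<dots> \<le> full_norm Z f * (full_norm Z g * nrm x)"
    using assms x by (intro mult_left_mono norm_le_full_norm[OF rep] full_norm_nonneg) auto
  finally show "nrm (A (convolution f g) x) \<le> full_norm Z f * full_norm Z g * nrm x"
    using assms x by (simp add: integrated_form_convolution mult.assoc)
qed (use assms in \<open>simp add: full_norm_nonneg\<close>)

lemma full_norm_l1_star:
  assumes "f \<in> l1" shows "full_norm Z (l1_star f) \<le> full_norm Z f"
proof (rule full_norm_le)
  fix H :: "('a \<Rightarrow> complex) hspace" and \<pi> x
  assume rep: "rep H Z \<pi>" and x: "x \<in> hvecs H"
  interpret rep H Z \<pi> by fact
  show "nrm (A (l1_star f) x) \<le> full_norm Z f * nrm x"
  proof (rule norm_le)
    fix z assume z: "z \<in> V"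
    have "cmod (ip x (A f z)) \<le> nrm x * nrm (A f z)"
      using assms x z by (intro Cauchy_Schwarz) auto
    also have "\<dots> \<le> nrm x * (full_norm Z f * nrm z)"
      using assms x z by (intro mult_left_mono norm_le_full_norm[OF rep]) auto
    finally show "cmod (ip (A (l1_star f) x) z) \<le> full_norm Z f * nrm x * nrm z"
      by (simp add: ip_integrated_form_star assms x z mult_ac)
  qed (use assms x in \<open>auto simp: l1_star_l1 full_norm_nonneg\<close>)
qed (use assms in \<open>simp add: full_norm_nonneg\<close>)

section \<open>Representations on arbitrary Hilbert spaces\<close>

text \<open>The vector \<open>\<pi>(1)x\<close> lies in the double orthocomplement \<open>K\<close> of its orbit, the
  coefficient map \<open>y \<mapsto> (p \<mapsto> \<langle>y, \<pi>(p)x\<rangle>)\<close> is injective on \<open>K\<close>, and \<open>\<pi>(f)x = \<pi>(f)\<pi>(1)x\<close>.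
  Thanks to the unit, no orthogonal projection onto \<open>K\<close> is needed.\<close>

lemma norm_le_full_norm_any:
  fixes H :: "'h hspace" and Z :: "'p::{inverse_semigroup, monoid_mult} set"
  assumes "rep H Z \<pi>" and f: "f \<in> l1" and x: "x \<in> hvecs H"
  shows "hnorm H (integrated_form H \<pi> f x) \<le> full_norm Z f * hnorm H x"
proof -
  interpret rep H Z \<pi> by fact
  define W where "W = range (\<lambda>p. \<pi> p x)"
  define K where "K = orth (orth W)"
  define H1 where "H1 = H\<lparr>hvecs := K\<rparr>"
  \<comment> \<open>The values of \<open>J\<close> are functions on the semigroup, the vector type
    over which \<open>full_norm\<close> ranges.\<close>
  define J where "J = (\<lambda>y p. ip y (\<pi> p x))"
  define H' where "H' = transport J H1"
  define \<pi>' where "\<pi>' = (\<lambda>p a. J (\<pi> p (the_inv_into K J a)))"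
  have WV: "W \<subseteq> V" using x by (auto simp: W_def)
  have oV: "orth U \<subseteq> V" for U by (auto simp: orth_def)
  have orthD: "ip y u = 0" if "y \<in> orth U" "u \<in> U" for U y u
    using that by (auto simp: orth_def)
  have KV: "y \<in> V" if "y \<in> K" for y using that oV by (auto simp: K_def)
  have WK: "w \<in> K" if w: "w \<in> W" for w
  proof -
    have "ip w y = 0" if "y \<in> orth W" for y
      using that w WV ip_commute[of y w] by (auto simp: orth_def)
    then show ?thesis using w WV by (auto simp: K_def orth_def)
  qed
  have W_inv: "\<pi> p w \<in> W" if "w \<in> W" for p w
    using that x by (auto simp: W_def simp flip: rep_mult)
  \<comment> \<open>The adjoint of \<open>\<pi> p\<close> is \<open>\<pi> (istar p)\<close>, which
    preserves \<open>U\<close> as well.\<close>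
  have orth_inv: "\<pi> p y \<in> orth U" if U: "U \<subseteq> V" "\<And>p u. u \<in> U \<Longrightarrow> \<pi> p u \<in> U" and y: "y \<in> orth U"
    for U p y
    using y U by (auto simp: orth_def rep_adjoint' subset_iff)
  have K_inv: "\<pi> p y \<in> K" if "y \<in> K" for p y
    using that unfolding K_def by (intro orth_inv oV W_inv WV)
  have inj: "inj_on J K"
  proof (rule inj_onI)
    fix y y' assume y: "y \<in> K" and y': "y' \<in> K" and "J y = J y'"
    then have "ip y w = ip y' w" if "w \<in> W" for w
      using that by (auto simp: J_def W_def fun_eq_iff)
    then have d: "vsub y y' \<in> orth W"
      using KV[OF y] KV[OF y'] WV by (auto simp: orth_def subset_iff)
    \<comment> \<open>Both vectors are orthogonal to \<open>orth W\<close>, and hence to their own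
      difference.\<close>
    have "ip y (vsub y y') = 0" "ip y' (vsub y y') = 0"
      using orthD[OF y[unfolded K_def] d] orthD[OF y'[unfolded K_def] d] by auto
    then show "y = y'"
      using KV[OF y] KV[OF y'] by (intro eq_if_ip_sub_eq_0) (simp_all del: ip_add_right)
  qed
  have hs1: "hilbert_space H1"
    unfolding H1_def K_def by (rule hilbert_space_orth[OF oV])
  then interpret H1: hilbert H1 by (rule hilbert.intro)
  have H1: "hvecs H1 = K" "hzero H1 = hzero H" "hadd H1 = hadd H" "hscale H1 = hscale H"
    "hinner H1 = hinner H"
    by (simp_all add: H1_def)
  have nH1: "hnorm H1 = hnorm H" by (simp add: hnorm_def H1 fun_eq_iff)
  have inj1: "inj_on J (hvecs H1)" using inj by (simp add: H1)
  note T = transport_simps[OF inj1, folded H'_def, unfolded H1 nH1]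
  have closed: "hzero H \<in> K" "\<And>a b. a \<in> K \<Longrightarrow> b \<in> K \<Longrightarrow> vadd a b \<in> K"
    "\<And>c a. a \<in> K \<Longrightarrow> scl c a \<in> K"
    using H1.zero_in H1.add_in H1.scale_in by (simp_all add: H1)
  have \<pi>': "\<pi>' p (J y) = J (\<pi> p y)" if "y \<in> K" for p y
    using that by (simp add: \<pi>'_def the_inv_into_f_f[OF inj])
  have hs': "hilbert_space H'"
    unfolding H'_def by (rule hilbert_space_transport[OF hs1 inj1])
  have "bounded_operator H' (\<pi>' p)" for p
    unfolding bounded_operator_def
  proof (intro conjI ballI allI exI)
    fix a assume "a \<in> hvecs H'"
    then show "hnorm H' (\<pi>' p a) \<le> 1 * hnorm H' a"
      using K_inv KV by (auto simp: T \<pi>' rep_contraction)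
  qed (auto simp: T \<pi>' K_inv closed KV rep_add rep_scale)
  then have "star_representation Z H' \<pi>'"
    unfolding star_representation_def
    by (auto simp: T \<pi>' K_inv closed KV rep_mult rep_adjoint rep_zero)
  then have rep': "rep H' Z \<pi>'" by (rule repI[OF hs'])
  then interpret H': rep H' Z \<pi>' .
  \<comment> \<open>The operator \<open>\<pi> 1\<close> may be a proper projection, so
    \<open>x\<close> itself can lie outside \<open>K\<close>, whereas \<open>\<pi> 1 x\<close> is a
    point of the orbit.\<close>
  let ?x = "\<pi> 1 x"
  have x': "?x \<in> W" by (simp add: W_def)
  have orbit: "\<pi> p ?x = \<pi> p x" for p
    using x by (simp flip: rep_mult)
  have Ax: "A f ?x = A f x"
    using x f by (intro integrated_form_eqI) (simp_all add: orbit ip_integrated_form)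
  \<comment> \<open>In the weak formula against a vector of \<open>orth W\<close> every term
    vanishes.\<close>
  have AK: "A f ?x \<in> K"
  proof -
    have "ip (A f ?x) w = 0" if w: "w \<in> orth W" for w
    proof -
      have "ip (\<pi> p ?x) w = 0" for p
        using WK[OF W_inv[OF x']] w by (auto simp: K_def orth_def)
      then show ?thesis
        using w x oV f by (subst ip_integrated_form) auto
    qed
    then show ?thesis using f x by (auto simp: K_def orth_def)
  qed
  \<comment> \<open>On \<open>K\<close> the map \<open>J\<close> preserves inner products and
    intertwines \<open>\<pi>\<close> with \<open>\<pi>'\<close>, so the two weak formulas
    agree.\<close>
  have "H'.A f (J ?x) = J (A f ?x)"
  proof (rule H'.integrated_form_eqI)
    show "J (A f ?x) \<in> hvecs H'" using AK by (simp add: T)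
    fix z assume "z \<in> hvecs H'"
    then obtain z' where z': "z = J z'" "z' \<in> K" by (auto simp: T)
    then show "hinner H' (J (A f ?x)) z = (\<Sum>\<^sub>\<infinity>p. f p * hinner H' (\<pi>' p (J ?x)) z)"
      using AK x f KV by (simp add: T \<pi>' WK[OF x'] K_inv ip_integrated_form)
  qed
  then have "nrm (A f ?x) = hnorm H' (H'.A f (J ?x))"
    by (simp add: T AK)
  also have "\<dots> \<le> full_norm Z f * hnorm H' (J ?x)"
    by (rule norm_le_full_norm[OF rep' f]) (simp add: T WK[OF x'])
  also have "\<dots> \<le> full_norm Z f * nrm x"
    using rep_contraction[OF x, of 1] full_norm_nonneg[OF f, of Z]
    by (simp add: T WK[OF x'] mult_left_mono)
  finally show ?thesis by (simp add: Ax)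
qed

text \<open>A representation of the target composed with \<open>\<psi>\<close> represents the
  source; \<open>Z\<close> goes to zero because its image lies in \<open>Z'\<close>. The integrated
  forms agree by \<open>infsum_push_mult\<close>.\<close>

lemma full_norm_push:
  fixes \<psi> :: "'p::{inverse_semigroup, monoid_mult} \<Rightarrow> 'q::inverse_semigroup"
  assumes hom: "\<And>x y. \<psi> (x * y) = \<psi> x * \<psi> y" and Z: "\<psi> ` Z \<subseteq> Z'" and f: "f \<in> l1"
  shows "full_norm Z' (push \<psi> f) \<le> full_norm Z f"
proof (rule full_norm_le[OF full_norm_nonneg[OF f]])
  fix H :: "('q \<Rightarrow> complex) hspace" and \<pi> x
  assume rep: "rep H Z' \<pi>" and x: "x \<in> hvecs H"
  interpret rep H Z' \<pi> by fact
  let ?\<sigma> = "\<lambda>p. \<pi> (\<psi> p)"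
  have "star_representation Z H ?\<sigma>"
    using Z by (auto simp: star_representation_def hom hom_istar[of \<psi>, OF hom] bounded_rep
        rep_mult rep_adjoint rep_zero image_subset_iff)
  then have rep': "rep H Z ?\<sigma>" by (rule repI[OF hilbert_space])
  then interpret s: rep H Z ?\<sigma> .
  have "A (push \<psi> f) x = s.A f x"
    using f x by (intro integrated_form_eqI)
      (auto simp: s.ip_integrated_form infsum_push_mult[OF f rep_coefficient_bound])
  then show "nrm (A (push \<psi> f) x) \<le> full_norm Z f * nrm x"
    using norm_le_full_norm_any[OF rep' f x] by simp
qed

section \<open>The completion\<close>

lemma full_norm_uminus:
  assumes "f \<in> l1" shows "full_norm Z (\<lambda>p. - f p) \<le> full_norm Z f"
  using full_norm_scale[OF assms, of Z "-1"] by simp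

lemma full_norm_diff_commute:
  assumes "f \<in> l1" "g \<in> l1"
  shows "full_norm Z (\<lambda>p. f p - g p) = full_norm Z (\<lambda>p. g p - f p)"
  using full_norm_uminus[OF l1_diff[OF assms], of Z] full_norm_uminus[OF l1_diff[OF assms(2,1)], of Z]
  by simp

lemma full_norm_diff_triangle:
  assumes "f \<in> l1" "g \<in> l1" "h \<in> l1"
  shows "full_norm Z (\<lambda>p. f p - h p) \<le> full_norm Z (\<lambda>p. f p - g p) + full_norm Z (\<lambda>p. g p - h p)"
  using full_norm_add[OF l1_diff[OF assms(1,2)] l1_diff[OF assms(2,3)], of Z] by simp

lemma full_norm_zero: "full_norm Z (\<lambda>p. 0) = 0"
proof -
  have "(\<lambda>p. 0) \<in> l1" by (simp add: l1_def)
  then show ?thesis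
    using full_norm_scale[of "\<lambda>p. 0" Z 0] full_norm_nonneg[of "\<lambda>p. 0" Z] by fastforce
qed

text \<open>Insert the mixed term \<open>convolution f g'\<close> and use
  submultiplicativity.\<close>

lemma convolution_diff_le:
  assumes "f \<in> l1" "f' \<in> l1" "g \<in> l1" "g' \<in> l1"
  shows "full_norm Z (\<lambda>p. convolution f g p - convolution f' g' p)
    \<le> full_norm Z g' * full_norm Z (\<lambda>p. f p - f' p) + full_norm Z f * full_norm Z (\<lambda>p. g p - g' p)"
proof -
  have "full_norm Z (\<lambda>p. convolution f g p - convolution f' g' p)
    \<le> full_norm Z (convolution f (\<lambda>p. g p - g' p)) + full_norm Z (convolution (\<lambda>p. f p - f' p) g')"
    using full_norm_diff_triangle[of "convolution f g" "convolution f g'" "convolution f' g'" Z] assms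
    by (simp add: convolution_l1 convolution_diff_left convolution_diff_right)
  then show ?thesis
    using full_norm_convolution[of f "\<lambda>p. g p - g' p" Z]
      full_norm_convolution[of "\<lambda>p. f p - f' p" g' Z] assms
    by (simp add: l1_diff mult.commute)
qed

lemma cauchy_seqs_l1: "X \<in> cauchy_seqs Z \<Longrightarrow> X n \<in> l1"
  by (simp add: cauchy_seqs_def)

lemma null_rel_cauchy: "(X, Y) \<in> null_rel Z \<Longrightarrow> X \<in> cauchy_seqs Z"
  "(X, Y) \<in> null_rel Z \<Longrightarrow> Y \<in> cauchy_seqs Z"
  by (auto simp: null_rel_def)

lemma cauchy_seqs_bounded:
  assumes X: "X \<in> cauchy_seqs Z" obtains C where "0 \<le> C" "\<And>n. full_norm Z (X n) \<le> C"
proof -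
  note l1 = cauchy_seqs_l1[OF X]
  obtain M where M: "\<And>m n. m \<ge> M \<Longrightarrow> n \<ge> M \<Longrightarrow> full_norm Z (\<lambda>p. X m p - X n p) < 1"
    using X unfolding cauchy_seqs_def mem_Collect_eq by (meson zero_less_one)
  \<comment> \<open>The sum dominates the first norms, including that of \<open>X M\<close>; the
    added 1 covers the distance of later terms from \<open>X M\<close>.\<close>
  define C where "C = (\<Sum>n\<le>M. full_norm Z (X n)) + 1"
  have part: "full_norm Z (X n) \<le> (\<Sum>n\<le>M. full_norm Z (X n))" if "n \<le> M" for n
    using that by (intro member_le_sum) (auto simp: full_norm_nonneg l1)
  have "full_norm Z (X n) \<le> C" for n
  proof (cases "n \<le> M")
    case True
    then show ?thesis using part[of n] by (simp add: C_def)
  next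
    case False
    have "full_norm Z (X n) \<le> full_norm Z (\<lambda>p. X n p - X M p) + full_norm Z (X M)"
      using full_norm_add[OF l1_diff[OF l1[of n] l1[of M]] l1[of M], of Z] by simp
    then show ?thesis
      using part[of M] M[of n M] False by (simp add: C_def)
  qed
  moreover have "0 \<le> C"
    unfolding C_def by (intro add_nonneg_nonneg sum_nonneg) (auto simp: full_norm_nonneg l1)
  ultimately show ?thesis using that by blast
qed

text \<open>A common pattern for the operations on representatives. Operations in one variable are
  covered by \<open>Y = X\<close> and \<open>b = 0\<close>.\<close>

lemma cauchy_seqs_combine:
  assumes X: "X \<in> cauchy_seqs Z" and Y: "Y \<in> cauchy_seqs Z" and l1: "\<And>n. W n \<in> l1"
    and "0 \<le> a" "0 \<le> b"
    and le: "\<And>m n. full_norm Z' (\<lambda>p. W m p - W n p)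
      \<le> a * full_norm Z (\<lambda>p. X m p - X n p) + b * full_norm Z (\<lambda>p. Y m p - Y n p)"
  shows "W \<in> cauchy_seqs Z'"
  unfolding cauchy_seqs_def mem_Collect_eq
proof (intro conjI allI impI l1)
  fix e :: real assume e: "0 < e"
  \<comment> \<open>The summand 1 keeps the denominator positive if \<open>a = b = 0\<close> and
    makes the final inequality strict.\<close>
  define d where "d = e / (a + b + 1)"
  have d: "0 < d" and "(a + b + 1) * d = e" using e assms(4,5) by (auto simp: d_def)
  then have less: "(a + b) * d < e" by (simp add: algebra_simps)
  obtain M where M: "\<And>m n. m \<ge> M \<Longrightarrow> n \<ge> M \<Longrightarrow> full_norm Z (\<lambda>p. X m p - X n p) < d"
    using X d unfolding cauchy_seqs_def mem_Collect_eq by meson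
  obtain M' where M': "\<And>m n. m \<ge> M' \<Longrightarrow> n \<ge> M' \<Longrightarrow> full_norm Z (\<lambda>p. Y m p - Y n p) < d"
    using Y d unfolding cauchy_seqs_def mem_Collect_eq by meson
  have "full_norm Z' (\<lambda>p. W m p - W n p) < e" if "m \<ge> max M M'" "n \<ge> max M M'" for m n
  proof -
    have "full_norm Z' (\<lambda>p. W m p - W n p) \<le> a * d + b * d"
      using that assms(4,5) M[of m n] M'[of m n]
      by (intro order_trans[OF le] add_mono mult_left_mono) auto
    then show ?thesis using less by (simp add: distrib_right)
  qed
  then show "\<exists>M. \<forall>m\<ge>M. \<forall>n\<ge>M. full_norm Z' (\<lambda>p. W m p - W n p) < e" by blast
qed

lemma null_rel_combine:
  assumes X: "(X, X') \<in> null_rel Z" and Y: "(Y, Y') \<in> null_rel Z"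
    and W: "W \<in> cauchy_seqs Z'" "W' \<in> cauchy_seqs Z'"
    and le: "\<And>n. full_norm Z' (\<lambda>p. W n p - W' n p)
      \<le> a * full_norm Z (\<lambda>p. X n p - X' n p) + b * full_norm Z (\<lambda>p. Y n p - Y' n p)"
  shows "(W, W') \<in> null_rel Z'"
proof -
  have "(\<lambda>n. a * full_norm Z (\<lambda>p. X n p - X' n p) + b * full_norm Z (\<lambda>p. Y n p - Y' n p))
      \<longlonglongrightarrow> a * 0 + b * 0"
    using X Y by (intro tendsto_intros) (auto simp: null_rel_def)
  then have "(\<lambda>n. full_norm Z' (\<lambda>p. W n p - W' n p)) \<longlonglongrightarrow> 0"
    using W by (intro tendsto_sandwich[OF _ always_eventually[OF allI[OF le]] tendsto_const])
      (auto simp: full_norm_nonneg l1_diff cauchy_seqs_l1)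
  then show ?thesis using W by (simp add: null_rel_def)
qed

lemma equiv_null_rel: "equiv (cauchy_seqs Z) (null_rel Z)"
proof (rule equivI)
  show "refl_on (cauchy_seqs Z) (null_rel Z)"
    by (auto simp: refl_on_def null_rel_def full_norm_zero)
  show "sym (null_rel Z)"
  proof (rule symI)
    fix X Y assume XY: "(X, Y) \<in> null_rel Z"
    have "full_norm Z (\<lambda>p. Y n p - X n p) = full_norm Z (\<lambda>p. X n p - Y n p)" for n
      using null_rel_cauchy[OF XY] by (intro full_norm_diff_commute cauchy_seqs_l1)
    then show "(Y, X) \<in> null_rel Z"
      using XY by (simp add: null_rel_def)
  qed
  show "trans (null_rel Z)"
  proof (rule transI)
    fix X Y W assume XY: "(X, Y) \<in> null_rel Z" and YW: "(Y, W) \<in> null_rel Z"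
    then show "(X, W) \<in> null_rel Z"
      using null_rel_cauchy[OF XY] null_rel_cauchy[OF YW]
      by (intro null_rel_combine[where a=1 and b=1, OF XY YW])
        (simp_all add: cauchy_seqs_l1 full_norm_diff_triangle)
  qed
qed (auto simp: null_rel_def)

lemma null_rel_refl: "X \<in> cauchy_seqs Z \<Longrightarrow> (X, X) \<in> null_rel Z"
  by (simp add: null_rel_def full_norm_zero)

text \<open>The operations of \<open>Cstar\<close> collect the results from all representatives; if
  these are equivalent to one result, the collection generates just its class.\<close>

lemma Image_class_eq:
  assumes "equiv A R" "y \<in> B" "\<And>x. x \<in> B \<Longrightarrow> (y, x) \<in> R"
  shows "R `` B = R `` {y}"
proof -
  have "R `` {x} = R `` {y}" if "x \<in> B" for x
    using equiv_class_eq[OF assms(1) assms(3)[OF that]] by simp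
  then show ?thesis using assms(2) by blast
qed

text \<open>A Lipschitz map of \<open>l1\<close> acts termwise on the completion. This serves for
  scalar multiples, the involution and \<open>push\<close>.\<close>

lemma
  assumes X: "X \<in> cauchy_seqs Z" and F: "\<And>f. f \<in> l1 \<Longrightarrow> F f \<in> l1" and "0 \<le> C"
    and le: "\<And>f g. f \<in> l1 \<Longrightarrow> g \<in> l1 \<Longrightarrow>
      full_norm Z' (\<lambda>p. F f p - F g p) \<le> C * full_norm Z (\<lambda>p. f p - g p)"
  shows lipschitz_cauchy_seqs: "(\<lambda>n. F (X n)) \<in> cauchy_seqs Z'"
    and lipschitz_class:
      "null_rel Z' `` {(\<lambda>n. F (Y n)) | Y. Y \<in> null_rel Z `` {X}} = null_rel Z' `` {\<lambda>n. F (X n)}"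
proof -
  have cauchy: "(\<lambda>n. F (Y n)) \<in> cauchy_seqs Z'" if "Y \<in> cauchy_seqs Z" for Y
    using that F le \<open>0 \<le> C\<close>
    by (intro cauchy_seqs_combine[where a=C and b=0, OF that that]) (auto simp: cauchy_seqs_l1)
  show "(\<lambda>n. F (X n)) \<in> cauchy_seqs Z'" by (rule cauchy[OF X])
  show "null_rel Z' `` {(\<lambda>n. F (Y n)) | Y. Y \<in> null_rel Z `` {X}} = null_rel Z' `` {\<lambda>n. F (X n)}"
  proof (rule Image_class_eq[OF equiv_null_rel])
    fix W assume "W \<in> {(\<lambda>n. F (Y n)) | Y. Y \<in> null_rel Z `` {X}}"
    then obtain Y where Y: "(X, Y) \<in> null_rel Z" and W: "W = (\<lambda>n. F (Y n))" by blast
    note YC = null_rel_cauchy(2)[OF Y]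
    show "(\<lambda>n. F (X n), W) \<in> null_rel Z'"
      unfolding W using le[OF cauchy_seqs_l1[OF X] cauchy_seqs_l1[OF YC]]
      by (intro null_rel_combine[where a=C and b=0, OF Y Y] cauchy X YC) simp
  qed (use X null_rel_refl in blast)
qed

section \<open>The operations on classes of Cauchy sequences\<close>

lemma
  assumes X: "X \<in> cauchy_seqs Z" and Y: "Y \<in> cauchy_seqs Z"
  shows add_cauchy_seqs: "(\<lambda>n p. X n p + Y n p) \<in> cauchy_seqs Z"
    and add_class: "aadd (Cstar Z) (null_rel Z `` {X}) (null_rel Z `` {Y})
      = null_rel Z `` {\<lambda>n p. X n p + Y n p}"
proof -
  have le: "full_norm Z (\<lambda>p. (f p + g p) - (f' p + g' p))
      \<le> 1 * full_norm Z (\<lambda>p. f p - f' p) + 1 * full_norm Z (\<lambda>p. g p - g' p)"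
    if "f \<in> l1" "g \<in> l1" "f' \<in> l1" "g' \<in> l1" for f g f' g'
    using full_norm_add[of "\<lambda>p. f p - f' p" "\<lambda>p. g p - g' p" Z] that
    by (simp add: l1_diff algebra_simps)
  have cauchy: "(\<lambda>n p. X n p + Y n p) \<in> cauchy_seqs Z"
    if X: "X \<in> cauchy_seqs Z" and Y: "Y \<in> cauchy_seqs Z" for X Y
    using cauchy_seqs_l1[OF X] cauchy_seqs_l1[OF Y]
    by (intro cauchy_seqs_combine[where a=1 and b=1, OF X Y] le) (auto simp: l1_add)
  show "(\<lambda>n p. X n p + Y n p) \<in> cauchy_seqs Z" by (rule cauchy[OF X Y])
  have "null_rel Z `` {(\<lambda>n p. X' n p + Y' n p) | X' Y'. X' \<in> null_rel Z `` {X} \<and> Y' \<in> null_rel Z `` {Y}}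
    = null_rel Z `` {\<lambda>n p. X n p + Y n p}"
  proof (rule Image_class_eq[OF equiv_null_rel])
    fix W assume "W \<in> {(\<lambda>n p. X' n p + Y' n p) | X' Y'. X' \<in> null_rel Z `` {X} \<and> Y' \<in> null_rel Z `` {Y}}"
    then obtain X' Y' where X': "(X, X') \<in> null_rel Z" and Y': "(Y, Y') \<in> null_rel Z"
      and W: "W = (\<lambda>n p. X' n p + Y' n p)" by blast
    note C = null_rel_cauchy(2)[OF X'] null_rel_cauchy(2)[OF Y']
    show "(\<lambda>n p. X n p + Y n p, W) \<in> null_rel Z"
      unfolding W by (intro null_rel_combine[where a=1 and b=1, OF X' Y'] cauchy X Y C le)
        (use X Y C cauchy_seqs_l1 in blast)+
  qed (use X Y null_rel_refl in blast)
  then show "aadd (Cstar Z) (null_rel Z `` {X}) (null_rel Z `` {Y})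
      = null_rel Z `` {\<lambda>n p. X n p + Y n p}"
    by (simp add: Cstar_def)
qed

text \<open>The product has no global Lipschitz constant, but Cauchy sequences are bounded in full
  norm, which gives constants for each given pair.\<close>

lemma
  assumes X: "X \<in> cauchy_seqs Z" and Y: "Y \<in> cauchy_seqs Z"
  shows convolution_cauchy_seqs: "(\<lambda>n. convolution (X n) (Y n)) \<in> cauchy_seqs Z"
    and amult_class: "amult (Cstar Z) (null_rel Z `` {X}) (null_rel Z `` {Y})
      = null_rel Z `` {\<lambda>n. convolution (X n) (Y n)}"
proof -
  have le: "full_norm Z (\<lambda>p. convolution f g p - convolution f' g' p)
      \<le> a * full_norm Z (\<lambda>p. f p - f' p) + b * full_norm Z (\<lambda>p. g p - g' p)"
    if "f \<in> l1" "f' \<in> l1" "g \<in> l1" "g' \<in> l1" "full_norm Z g' \<le> a" "full_norm Z f \<le> b"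
    for f g f' g' a b
    using that by (intro order_trans[OF convolution_diff_le] add_mono mult_right_mono)
      (auto simp: full_norm_nonneg l1_diff)
  have cauchy: "(\<lambda>n. convolution (X n) (Y n)) \<in> cauchy_seqs Z"
    if X: "X \<in> cauchy_seqs Z" and Y: "Y \<in> cauchy_seqs Z" for X Y
  proof -
    obtain b where b: "0 \<le> b" "\<And>n. full_norm Z (X n) \<le> b" by (rule cauchy_seqs_bounded[OF X]) (rule that)
    obtain a where a: "0 \<le> a" "\<And>n. full_norm Z (Y n) \<le> a" by (rule cauchy_seqs_bounded[OF Y]) (rule that)
    show ?thesis
      using cauchy_seqs_l1[OF X] cauchy_seqs_l1[OF Y] a b
      by (intro cauchy_seqs_combine[where a=a and b=b, OF X Y] le) (auto simp: convolution_l1)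
  qed
  show "(\<lambda>n. convolution (X n) (Y n)) \<in> cauchy_seqs Z" by (rule cauchy[OF X Y])
  have "null_rel Z `` {(\<lambda>n. convolution (X' n) (Y' n)) | X' Y'. X' \<in> null_rel Z `` {X} \<and> Y' \<in> null_rel Z `` {Y}}
    = null_rel Z `` {\<lambda>n. convolution (X n) (Y n)}"
  proof (rule Image_class_eq[OF equiv_null_rel])
    fix W assume "W \<in> {(\<lambda>n. convolution (X' n) (Y' n)) | X' Y'. X' \<in> null_rel Z `` {X} \<and> Y' \<in> null_rel Z `` {Y}}"
    then obtain X' Y' where X': "(X, X') \<in> null_rel Z" and Y': "(Y, Y') \<in> null_rel Z"
      and W: "W = (\<lambda>n. convolution (X' n) (Y' n))" by blast
    note C = null_rel_cauchy(2)[OF X'] null_rel_cauchy(2)[OF Y']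
    \<comment> \<open>In \<open>convolution_diff_le\<close> the factors are the norms of the first
      left and the second right operand, hence bounds for \<open>X\<close> and
      \<open>Y'\<close>.\<close>
    obtain b where b: "0 \<le> b" "\<And>n. full_norm Z (X n) \<le> b" by (rule cauchy_seqs_bounded[OF X]) (rule that)
    obtain a where a: "0 \<le> a" "\<And>n. full_norm Z (Y' n) \<le> a"
      by (rule cauchy_seqs_bounded[OF C(2)]) (rule that)
    show "(\<lambda>n. convolution (X n) (Y n), W) \<in> null_rel Z"
      unfolding W by (intro null_rel_combine[where a=a and b=b, OF X' Y'] cauchy X Y C le a(2) b(2))
        (use X Y C cauchy_seqs_l1 in blast)+
  qed (use X Y null_rel_refl in blast)
  then show "amult (Cstar Z) (null_rel Z `` {X}) (null_rel Z `` {Y})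
      = null_rel Z `` {\<lambda>n. convolution (X n) (Y n)}"
    by (simp add: Cstar_def)
qed

lemma
  assumes X: "X \<in> cauchy_seqs Z"
  shows scale_cauchy_seqs: "(\<lambda>n p. c * X n p) \<in> cauchy_seqs Z"
    and scale_class: "ascale (Cstar Z) c (null_rel Z `` {X}) = null_rel Z `` {\<lambda>n p. c * X n p}"
proof -
  have le: "full_norm Z (\<lambda>p. c * f p - c * g p) \<le> cmod c * full_norm Z (\<lambda>p. f p - g p)"
    if "f \<in> l1" "g \<in> l1" for f g
    using full_norm_scale[OF l1_diff[OF that], of Z c] by (simp add: right_diff_distrib)
  show "(\<lambda>n p. c * X n p) \<in> cauchy_seqs Z"
    by (rule lipschitz_cauchy_seqs[where F="\<lambda>f p. c * f p", OF X l1_scale norm_ge_zero le])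
  show "ascale (Cstar Z) c (null_rel Z `` {X}) = null_rel Z `` {\<lambda>n p. c * X n p}"
    unfolding Cstar_def star_algebra.simps
    by (rule lipschitz_class[where F="\<lambda>f p. c * f p", OF X l1_scale norm_ge_zero le])
qed

lemma
  assumes X: "X \<in> cauchy_seqs Z"
  shows star_cauchy_seqs: "(\<lambda>n. l1_star (X n)) \<in> cauchy_seqs Z"
    and star_class: "astar (Cstar Z) (null_rel Z `` {X}) = null_rel Z `` {\<lambda>n. l1_star (X n)}"
proof -
  have le: "full_norm Z (\<lambda>p. l1_star f p - l1_star g p) \<le> 1 * full_norm Z (\<lambda>p. f p - g p)"
    if "f \<in> l1" "g \<in> l1" for f g
    using full_norm_l1_star[OF l1_diff[OF that], of Z] by (simp add: l1_star_def)
  show "(\<lambda>n. l1_star (X n)) \<in> cauchy_seqs Z"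
    by (rule lipschitz_cauchy_seqs[where F=l1_star, OF X l1_star_l1 zero_le_one le])
  show "astar (Cstar Z) (null_rel Z `` {X}) = null_rel Z `` {\<lambda>n. l1_star (X n)}"
    unfolding Cstar_def star_algebra.simps
    by (rule lipschitz_class[where F=l1_star, OF X l1_star_l1 zero_le_one le])
qed

lemma acarrier_Cstar: "acarrier (Cstar Z) = {null_rel Z `` {X} | X. X \<in> cauchy_seqs Z}"
  by (auto simp: Cstar_def quotient_def)

section \<open>Functoriality\<close>

proposition Cstar_functorial:
  fixes \<psi> :: "'p::{inverse_semigroup, monoid_mult} \<Rightarrow> 'q::inverse_semigroup"
  assumes hom: "\<And>x y. \<psi> (x * y) = \<psi> x * \<psi> y" and Z: "\<psi> ` Z \<subseteq> Z'"
  shows "\<exists>\<Phi>. star_homomorphism (Cstar Z) (Cstar Z') \<Phi> \<and>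
    (\<forall>p. \<Phi> (Cstar_elem Z p) = Cstar_elem Z' (\<psi> p))"
proof -
  \<comment> \<open>Using the images of all representatives avoids a choice and matches the form of
    the operations in \<open>Cstar\<close>.\<close>
  define \<Phi> where "\<Phi> = (\<lambda>A. null_rel Z' `` {(\<lambda>n. push \<psi> (X n)) | X. X \<in> A})"
  have le: "full_norm Z' (\<lambda>q. push \<psi> f q - push \<psi> g q) \<le> 1 * full_norm Z (\<lambda>p. f p - g p)"
    if "f \<in> l1" "g \<in> l1" for f g
    using full_norm_push[of \<psi>, OF hom Z l1_diff[OF that]] that by (simp add: push_diff)
  have cauchy: "(\<lambda>n. push \<psi> (X n)) \<in> cauchy_seqs Z'" if "X \<in> cauchy_seqs Z" for X
    by (rule lipschitz_cauchy_seqs[OF that push_l1 zero_le_one le])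
  have \<Phi>: "\<Phi> (null_rel Z `` {X}) = null_rel Z' `` {\<lambda>n. push \<psi> (X n)}" if "X \<in> cauchy_seqs Z" for X
    unfolding \<Phi>_def by (rule lipschitz_class[OF that push_l1 zero_le_one le])
  have "star_homomorphism (Cstar Z) (Cstar Z') \<Phi>"
    unfolding star_homomorphism_def
  proof (intro conjI ballI allI)
    fix A assume "A \<in> acarrier (Cstar Z)"
    then obtain X where A: "A = null_rel Z `` {X}" and X: "X \<in> cauchy_seqs Z"
      by (auto simp: acarrier_Cstar)
    show "\<Phi> A \<in> acarrier (Cstar Z')"
      using cauchy[OF X] by (auto simp: A \<Phi>[OF X] acarrier_Cstar)
    show "\<Phi> (ascale (Cstar Z) c A) = ascale (Cstar Z') c (\<Phi> A)" for c
      by (simp add: A scale_class scale_cauchy_seqs X \<Phi> cauchy push_scale)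
    show "\<Phi> (astar (Cstar Z) A) = astar (Cstar Z') (\<Phi> A)"
      by (simp add: A star_class star_cauchy_seqs X \<Phi> cauchy push_l1_star[of \<psi>, OF hom])
    fix B assume "B \<in> acarrier (Cstar Z)"
    then obtain Y where B: "B = null_rel Z `` {Y}" and Y: "Y \<in> cauchy_seqs Z"
      by (auto simp: acarrier_Cstar)
    show "\<Phi> (aadd (Cstar Z) A B) = aadd (Cstar Z') (\<Phi> A) (\<Phi> B)"
      by (simp add: A B add_class add_cauchy_seqs X Y \<Phi> cauchy
          push_add[OF cauchy_seqs_l1[OF X] cauchy_seqs_l1[OF Y]])
    show "\<Phi> (amult (Cstar Z) A B) = amult (Cstar Z') (\<Phi> A) (\<Phi> B)"
      by (simp add: A B amult_class convolution_cauchy_seqs X Y \<Phi> cauchy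
          push_convolution[of \<psi>, OF hom cauchy_seqs_l1[OF X] cauchy_seqs_l1[OF Y]])
  qed
  moreover have "\<Phi> (Cstar_elem Z p) = Cstar_elem Z' (\<psi> p)" for p
  proof -
    have "(\<lambda>n. point_mass p) \<in> cauchy_seqs Z"
      by (auto simp: cauchy_seqs_def point_mass_l1 full_norm_zero)
    then show ?thesis by (simp add: Cstar_elem_def \<Phi> push_point_mass)
  qed
  ultimately show ?thesis by blast
qed

section \<open>The homomorphism between universal inverse semigroups induced by \<phi>\<close>

lemma hom_one:
  fixes \<phi> :: "'s::left_cancel_monoid \<Rightarrow> 't::left_cancel_monoid"
  assumes "\<And>s t. \<phi> (s * t) = \<phi> s * \<phi> t" shows "\<phi> 1 = 1"
  \<comment> \<open>Cancel the left factor in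
    \<open>\<phi> 1 * \<phi> 1 = \<phi> 1 * 1\<close>.\<close>
  using assms[of 1 1] left_cancel[of "\<phi> 1" "\<phi> 1" 1] by simp

primrec eval_term :: "('x \<Rightarrow> 'p::inverse_semigroup) \<Rightarrow> 'x inv_term \<Rightarrow> 'p" where
  "eval_term h (Gen x) = h x"
| "eval_term h (Prod a b) = eval_term h a * eval_term h b"
| "eval_term h (Star a) = istar (eval_term h a)"

text \<open>Soundness of the equational theory. The rules \<open>star_prod\<close> and
  \<open>comm\<close> are the substantial ones; both rest on commuting idempotents.\<close>

lemma eval_term_cong: "inv_eq a b \<Longrightarrow> eval_term h a = eval_term h b"
proof (induction rule: inv_eq.induct)
  case (comm a b)
  show ?case
    using idempotents_commute[of "eval_term h a * istar (eval_term h a)"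
        "eval_term h b * istar (eval_term h b)"]
    by (simp add: idempotent_mult_istar)
next
  case (regular a)
  then show ?case by (simp add: mult_istar_mult)
qed (simp_all add: mult.assoc istar_istar istar_mult)

definition free_lift :: "('x \<Rightarrow> 'p::inverse_semigroup) \<Rightarrow> 'x free_inv \<Rightarrow> 'p" where
  "free_lift h a = eval_term h (rep_free_inv a)"

lemma free_lift_abs: "free_lift h (abs_free_inv t) = eval_term h t"
  unfolding free_lift_def
  by (rule eval_term_cong) (metis Quotient3_free_inv Quotient3_rep_abs inv_eq.refl)

lemma free_lift_simps:
  "free_lift h (free_gen x) = h x"
  "free_lift h (a * b) = free_lift h a * free_lift h b"
  "free_lift h (istar a) = istar (free_lift h a)"
proof -
  obtain s t where ab: "a = abs_free_inv s" "b = abs_free_inv t"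
    by (metis Quotient3_abs_rep Quotient3_free_inv)
  show "free_lift h (free_gen x) = h x" "free_lift h (a * b) = free_lift h a * free_lift h b"
    "free_lift h (istar a) = istar (free_lift h a)"
    by (simp_all add: ab free_gen.abs_eq times_free_inv.abs_eq istar_free_inv.abs_eq free_lift_abs)
qed

text \<open>Induction on the congruence: the generating relations go to \<open>v_mult\<close> and
  \<open>v_isometry\<close>, the latter with the help of \<open>hom_one\<close>.\<close>

lemma free_lift_cong:
  fixes \<phi> :: "'s::left_cancel_monoid \<Rightarrow> 't::left_cancel_monoid"
  assumes hom: "\<And>s t. \<phi> (s * t) = \<phi> s * \<phi> t" and "univ_inv_cong a b"
  shows "free_lift (\<lambda>s. v (\<phi> s)) a = free_lift (\<lambda>s. v (\<phi> s)) b"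
  using assms(2)
  by induction (simp_all add: free_lift_simps hom v_mult v_isometry hom_one[of \<phi>, OF hom])

lemma univ_inv_lift:
  fixes \<phi> :: "'s::left_cancel_monoid \<Rightarrow> 't::left_cancel_monoid"
  assumes hom: "\<And>s t. \<phi> (s * t) = \<phi> s * \<phi> t"
  obtains \<psi> :: "'s univ_inv \<Rightarrow> 't univ_inv"
  where "\<And>x y. \<psi> (x * y) = \<psi> x * \<psi> y" "\<And>s. \<psi> (v s) = v (\<phi> s)"
proof
  let ?\<psi> = "\<lambda>x. free_lift (\<lambda>s. v (\<phi> s)) (rep_univ_inv x)"
  have abs: "?\<psi> (abs_univ_inv a) = free_lift (\<lambda>s. v (\<phi> s)) a" for a
    by (rule free_lift_cong[of \<phi>, OF hom])
      (metis Quotient3_univ_inv Quotient3_rep_abs univ_inv_cong.refl)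
  show "?\<psi> (x * y) = ?\<psi> x * ?\<psi> y" for x y
    by (metis Quotient3_abs_rep[OF Quotient3_univ_inv] times_univ_inv.abs_eq abs free_lift_simps(2))
  show "?\<psi> (v s) = v (\<phi> s)" for s
    by (simp only: v.abs_eq[of s] abs free_lift_simps)
qed

text \<open>The conjuncts treat the two conventions for zeros. If zeros must be sent to
  \<open>0\<close>, the induced map has to preserve them, which is not automatic: for trivial
  \<open>S\<close> the unit is a zero, but its image \<open>v 1\<close> usually is not. Since the
  elements \<open>v s\<close> generate, the quantifier over \<open>\<psi>\<close> refers to exactly
  one map.\<close>

theorem proposition5p6:
  fixes \<phi> :: "'s::left_cancel_monoid \<Rightarrow> 't::left_cancel_monoid"
  assumes hom: "\<And>s t. \<phi> (s * t) = \<phi> s * \<phi> t"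
  shows "(\<exists>\<Phi>. star_homomorphism
                (Cstar ({} :: 's univ_inv set)) (Cstar ({} :: 't univ_inv set)) \<Phi> \<and>
              (\<forall>s. \<Phi> (Cstar_elem {} (v s)) = Cstar_elem {} (v (\<phi> s)))) \<and>
         ((\<forall>\<psi> :: 's univ_inv \<Rightarrow> 't univ_inv.
              (\<forall>x y. \<psi> (x * y) = \<psi> x * \<psi> y) \<and> (\<forall>s. \<psi> (v s) = v (\<phi> s))
              \<longrightarrow> \<psi> ` zero_elements \<subseteq> zero_elements) \<longrightarrow>
          (\<exists>\<Phi>. star_homomorphism
                (Cstar (zero_elements :: 's univ_inv set))
                (Cstar (zero_elements :: 't univ_inv set)) \<Phi> \<and>
              (\<forall>s. \<Phi> (Cstar_elem zero_elements (v s)) = Cstar_elem zero_elements (v (\<phi> s)))))"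
proof -
  obtain \<psi> :: "'s univ_inv \<Rightarrow> 't univ_inv"
    where \<psi>: "\<And>x y. \<psi> (x * y) = \<psi> x * \<psi> y" "\<And>s. \<psi> (v s) = v (\<phi> s)"
    using univ_inv_lift[of \<phi>, OF hom] by blast
  have "\<exists>\<Phi>. star_homomorphism (Cstar Z) (Cstar Z') \<Phi> \<and>
      (\<forall>s. \<Phi> (Cstar_elem Z (v s)) = Cstar_elem Z' (v (\<phi> s)))" if Z: "\<psi> ` Z \<subseteq> Z'" for Z Z'
    using Cstar_functorial[of \<psi>, OF \<psi>(1) Z] \<psi>(2) by metis
  then show ?thesis using \<psi> by (intro conjI impI) auto
qed

end
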